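(* Let $p>3$ be a prime, $h\geq 1$, $q=p^h$, and $a,b\in\mathbb{F}_{q^2}^*$. The polynomial $$f_{a,b}(X)=X\bigl(1+aX^{q(q-1)}+bX^{2(q-1)}\bigr)\in\mathbb{F}_{q^2}[X]$$ is a permutation polynomial of $\mathbb{F}_{q^2}$ if and only if either $$\text{(I)}\quad a^qb^q=a\bigl(b^{q+1}-a^{q+1}\bigr)\ \text{ and }\ 1-4(b/a)^{q+1}\in\square_q^*,$$ or $$\text{(II)}\quad a^{q-1}+3b=0\ \text{ and }\ -3\bigl(1-4(b/a)^{q+1}\bigr)\in\square_q^*.$$
   Context: A polynomial $f\in\mathbb{F}_{q^2}[X]$ is a permutation polynomial (PP) of $\mathbb{F}_{q^2}$ if $x\mapsto f(x)$ is a bijection of $\mathbb{F}_{q^2}$. $\square_q^*$ denotes the set of nonzero squares of $\mathbb{F}_q$. *)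

theory Defs
  imports Main "HOL-Computational_Algebra.Primes"
begin

text \<open>The ambient field F_{q^2} is a finite field type 'a with CARD('a) = q^2.
  The subfield F_q is the set of fixed points of the Frobenius x \<mapsto> x^q.
  nonzero_squares_Fq q is the set of nonzero squares of F_q.\<close>

definition nonzero_squares_Fq :: "nat \<Rightarrow> 'a::field set" where
  "nonzero_squares_Fq q = {x. \<exists>y. y ^ q = y \<and> y \<noteq> 0 \<and> x = y ^ 2}"

definition is_perm_poly_fun :: "('a::finite \<Rightarrow> 'a) \<Rightarrow> bool" where
  "is_perm_poly_fun f \<longleftrightarrow> bij f"

end

theory Submission
  imports Defs "HOL-Computational_Algebra.Polynomial"
begin

text \<open>
  Write \<open>x'\<close> for \<open>x ^ q\<close>. Since \<open>f(cX) = c f(X)\<close> for \<open>c\<close> in the subfield with \<open>q\<close> elements, \<open>f\<close> is a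
  permutation iff \<open>g = N/D\<close> with \<open>N = a'x\<^sup>3 + x\<^sup>2 + b'\<close>, \<open>D = bx\<^sup>3 + x + a\<close> is injective on the circle
  \<open>x ^ (q + 1) = 1\<close>. Dividing \<open>N(x)D(y) - N(y)D(x)\<close> by \<open>x - y\<close> leaves a quadratic in \<open>y\<close> which has a
  root on the circle iff its normalised discriminant \<open>P(x)/x\<^sup>2\<close> is not a nonzero square; here \<open>P\<close> is a
  quartic. So injectivity forces \<open>P(x)/x\<^sup>2\<close> to be a nonzero square at every point of the circle, except
  at double zeros of \<open>P\<close>. A Stepanov-type argument, used in place of the Hasse bound for the curve
  \<open>y\<^sup>2 = P(x)\<close>, shows that then \<open>P\<close> is a constant times a square. In terms of \<open>a\<close> and \<open>b\<close> this means
  that (I) or (II) holds up to the square conditions, or that \<open>N\<close> and \<open>D\<close> have a common zero on the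
  circle, which injectivity excludes. In case (I) \<open>g\<close> has degree one after cancellation, in case (II) the
  discriminant is an explicit constant times a square; both directions are then read off.
\<close>

section \<open>Finite fields of square order\<close>

text \<open>Translation by 1 permutes the ring, so it does not change the sum of all
  elements.\<close>

lemma of_nat_card_finite_ring: "of_nat (card (UNIV :: 'a::{ring_1,finite} set)) = (0 :: 'a)"
proof -
  have "(\<Sum>y\<in>UNIV. y + (1::'a)) = (\<Sum>y\<in>UNIV. y)"
    by (rule sum.reindex_bij_witness[of _ "\<lambda>y. y - 1" "\<lambda>y. y + 1"]) auto
  then show ?thesis by (simp add: sum.distrib)
qed

lemma finite_field_power_card_minus_1:
  fixes x :: "'a::{field,finite}"
  assumes "x \<noteq> 0"
  shows "x ^ (card (UNIV :: 'a set) - 1) = 1"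
proof -
  have "(\<Prod>y\<in>UNIV-{0}. x * y) = (\<Prod>y\<in>UNIV-{0}. y)"
    by (rule prod.reindex_bij_witness[of _ "\<lambda>y. y / x" "\<lambda>y. x * y"]) (use assms in auto)
  moreover have "(\<Prod>y\<in>UNIV-{0::'a}. y) \<noteq> 0" by simp
  ultimately show ?thesis by (simp add: prod.distrib)
qed

lemma add_power_prime_of_nat_0:
  fixes x y :: "'a::comm_ring_1"
  assumes "prime p" "of_nat p = (0::'a)"
  shows "(x + y) ^ p = x ^ p + y ^ p"
proof -
  have p: "p > 0" using assms(1) by (simp add: prime_gt_0_nat)
  have mid: "of_nat (p choose k) * x ^ k * y ^ (p - k) = 0" if "k \<in> {0<..<p}" for k
  proof -
    have "p dvd (p choose k)" using that assms(1) by (intro dvd_choose_prime) auto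
    then show ?thesis using assms(2) by (auto simp: dvd_def)
  qed
  have "{..p} = insert 0 (insert p {0<..<p})" using p by auto
  then have "(x + y) ^ p = y ^ p + (x ^ p + (\<Sum>k\<in>{0<..<p}. of_nat (p choose k) * x ^ k * y ^ (p - k)))"
    using p by (simp add: binomial_ring)
  then show ?thesis using mid by (simp add: sum.neutral)
qed

lemma add_power_prime_power_of_nat_0:
  fixes x y :: "'a::comm_ring_1"
  assumes "prime p" "of_nat p = (0::'a)"
  shows "(x + y) ^ (p ^ h) = x ^ (p ^ h) + y ^ (p ^ h)"
proof (induction h arbitrary: x y)
  case (Suc h)
  then show ?case
    by (simp only: power_Suc power_mult add_power_prime_of_nat_0[OF assms])
qed simp

lemma degree_monom_minus_1: "m > 0 \<Longrightarrow> degree (monom 1 m - 1 :: 'a::comm_ring_1 poly) = m"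
  using degree_add_eq_left[of "-1 :: 'a poly" "monom 1 m"] by (simp add: degree_monom_eq)

lemma card_roots_of_unity_le:
  assumes "m > 0"
  shows "card {x::'a::idom. x ^ m = 1} \<le> m"
proof -
  have "monom 1 m - 1 \<noteq> (0 :: 'a poly)"
    using assms degree_monom_minus_1[of m, where 'a='a] by auto
  from card_poly_roots_bound[OF this] show ?thesis
    using assms by (simp add: degree_monom_minus_1 poly_monom)
qed

text \<open>\<open>cj\<close> is a parameter pinned down by \<open>cj_eq\<close>, so that the
  simplifier meets an opaque automorphism and not a power; the final instance puts
  \<open>x ^ q\<close> back.\<close>

locale quadratic_ext =
  fixes p h q :: nat and cj :: "'a::{field,finite} \<Rightarrow> 'a"
  assumes prime_p: "prime p" and p_gt_3: "p > 3" and h_ge_1: "h \<ge> 1" and q_eq: "q = p ^ h"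
    and card_field: "card (UNIV :: 'a set) = q ^ 2" and cj_eq: "cj = (\<lambda>x. x ^ q)"
begin

definition mu :: "'a set" where "mu = {x. x ^ (q + 1) = 1}"

lemma p_le_q: "p \<le> q"
  using h_ge_1 prime_p unfolding q_eq
  by (metis One_nat_def Suc_le_eq dvd_imp_le dvd_power prime_gt_0_nat zero_less_power)

lemma p_ge_5: "p \<ge> 5"
proof -
  have "p \<noteq> 4" using prime_p by (auto dest: prime_odd_nat)
  then show ?thesis using p_gt_3 by simp
qed

lemma q_ge_5: "q \<ge> 5"
  using p_le_q p_ge_5 by simp

lemma odd_q: "odd q"
  using prime_p p_gt_3 unfolding q_eq by (simp add: prime_odd_nat)

lemma q_cases: "q = 5 \<or> q \<ge> 7"
  using q_ge_5 odd_q by (cases "q = 6") auto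

lemma of_nat_p: "of_nat p = (0::'a)"
proof -
  have "of_nat (q ^ 2) = (0::'a)" using of_nat_card_finite_ring[where 'a='a] card_field by simp
  then show ?thesis by (simp add: q_eq)
qed

lemma of_nat_q: "of_nat q = (0::'a)"
  using h_ge_1 by (simp add: q_eq of_nat_p)

lemma of_nat_nonzero: "0 < n \<Longrightarrow> n < p \<Longrightarrow> of_nat n \<noteq> (0::'a)"
proof
  assume n: "0 < n" "n < p" and 0: "of_nat n = (0::'a)"
  then have "coprime n p" using prime_p by (metis coprime_commute nat_dvd_not_less prime_imp_coprime)
  then obtain s t where "n * s = p * t + 1" using n by (metis bezout_nat coprime_imp_gcd_eq_1 not_gr0)
  then have "of_nat n * of_nat s = of_nat p * of_nat t + (1::'a)"
    by (metis of_nat_1 of_nat_add of_nat_mult)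
  then show False using 0 of_nat_p by simp
qed

lemma two_nonzero [simp]: "(2::'a) \<noteq> 0" and three_nonzero [simp]: "(3::'a) \<noteq> 0"
  using of_nat_nonzero[of 2] of_nat_nonzero[of 3] p_gt_3 by auto

lemma four_nonzero [simp]: "(4::'a) \<noteq> 0"
  using two_nonzero by (metis mult_2 mult_eq_0_iff numeral_Bit0)

lemma three_smooth_nonzero [simp]:
  "(8::'a) \<noteq> 0" "(9::'a) \<noteq> 0" "(27::'a) \<noteq> 0" "(81::'a) \<noteq> 0" "(243::'a) \<noteq> 0" "(729::'a) \<noteq> 0"
proof -
  have "2 ^ i * 3 ^ j \<noteq> (0::'a)" for i j by simp
  from this[of 3 0] this[of 0 2] this[of 0 3] this[of 0 4] this[of 0 5] this[of 0 6]
  show "(8::'a) \<noteq> 0" "(9::'a) \<noteq> 0" "(27::'a) \<noteq> 0" "(81::'a) \<noteq> 0" "(243::'a) \<noteq> 0" "(729::'a) \<noteq> 0" by simp_all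
qed

lemma power_q2_minus_1: "x \<noteq> 0 \<Longrightarrow> x ^ (q ^ 2 - 1) = (1::'a)"
  using finite_field_power_card_minus_1[of x] card_field by simp

lemma cj_cj [simp]: "cj (cj x) = x"
proof (cases "x = 0")
  case False
  have "cj (cj x) = x ^ (q ^ 2)" by (simp add: cj_eq power2_eq_square power_mult)
  also have "q ^ 2 = Suc (q ^ 2 - 1)" using q_ge_5 by simp
  finally show ?thesis using power_q2_minus_1[OF False] by (metis mult.right_neutral power_Suc)
qed (use q_ge_5 in \<open>simp add: cj_eq\<close>)

lemma cj_add [simp]: "cj (x + y) = cj x + cj y"
  unfolding cj_eq q_eq by (rule add_power_prime_power_of_nat_0[OF prime_p of_nat_p])

lemma cj_mult [simp]: "cj (x * y) = cj x * cj y"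
  and cj_divide [simp]: "cj (x / y) = cj x / cj y"
  and cj_power [simp]: "cj (x ^ n) = cj x ^ n"
  and cj_1 [simp]: "cj 1 = 1"
  by (simp_all add: cj_eq power_mult_distrib power_divide flip: power_mult) (simp add: mult.commute)

lemma cj_0 [simp]: "cj 0 = 0"
  using q_ge_5 by (simp add: cj_eq)

lemma cj_uminus [simp]: "cj (- x) = - cj x"
  using odd_q by (simp add: cj_eq)

lemma cj_diff [simp]: "cj (x - y) = cj x - cj y"
  using cj_add[of x "- y"] by simp

lemma cj_numeral [simp]: "cj (numeral n) = numeral n"
proof -
  have "cj (of_nat m) = of_nat m" for m by (induction m) simp_all
  from this[of "numeral n"] show ?thesis by simp
qed

lemma cj_eq_0_iff [simp]: "cj x = 0 \<longleftrightarrow> x = 0"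
  using q_ge_5 by (simp add: cj_eq)

lemma mu_iff: "x \<in> mu \<longleftrightarrow> x * cj x = 1"
  by (simp add: mu_def cj_eq)

lemma mu_nonzero: "x \<in> mu \<Longrightarrow> x \<noteq> 0"
  by (auto simp: mu_iff)

lemma cj_mu: "x \<in> mu \<Longrightarrow> cj x = 1 / x"
  using mu_nonzero[of x] by (simp add: mu_iff eq_divide_eq mult.commute)

lemma mult_mu: "x \<in> mu \<Longrightarrow> z \<in> mu \<Longrightarrow> x * z \<in> mu"
  unfolding mu_def by (simp only: mem_Collect_eq power_mult_distrib mult_1)

lemma minus_mu:
  assumes "x \<in> mu"
  shows "- x \<in> mu" "- x \<noteq> x"
proof -
  show "- x \<in> mu" using assms by (simp add: mu_iff)
  have "2 * x \<noteq> 0" using mu_nonzero[OF assms] by simp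
  then show "- x \<noteq> x" by (metis add.right_inverse mult_2)
qed

text \<open>Counting replaces cyclicity of the multiplicative group: fibres have at most
  \<open>n\<close> elements and the image lies among at most \<open>m\<close> roots of unity, while
  there are \<open>n * m\<close> nonzero elements. Hence both bounds are attained.\<close>

lemma power_surj_on_roots_of_unity:
  assumes nm: "n * m = q ^ 2 - 1"
  shows "(\<lambda>y. y ^ n) ` (UNIV - {0::'a}) = {x. x ^ m = 1}" and "card {x::'a. x ^ m = 1} = m"
proof -
  have "q * q > 1" using q_ge_5 by (metis less_1_mult less_le_trans one_less_numeral_iff semiring_norm(77))
  then have "n * m \<noteq> 0" using nm by (simp add: power2_eq_square)
  then have n: "n > 0" and m: "m > 0" by simp_all
  let ?I = "(\<lambda>y. y ^ n) ` (UNIV - {0::'a})"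
  have sub: "?I \<subseteq> {x. x ^ m = 1}"
    using power_q2_minus_1 by (auto simp: nm power_mult[symmetric])
  have fib: "card {y \<in> UNIV - {0}. y ^ n = z} \<le> n" if z: "z \<in> ?I" for z :: 'a
  proof -
    obtain w where w: "w \<noteq> 0" "z = w ^ n" using z by auto
    have "card {y \<in> UNIV - {0}. y ^ n = z} \<le> card {x::'a. x ^ n = 1}"
      using w by (intro card_inj_on_le[where f = "\<lambda>y. y / w"]) (auto simp: inj_on_def power_divide)
    also have "\<dots> \<le> n" by (rule card_roots_of_unity_le[OF n])
    finally show ?thesis .
  qed
  have "n * m = card (UNIV - {0::'a})" using card_field nm by (simp add: card_Diff_singleton)
  also have "\<dots> = (\<Sum>z\<in>?I. card {y \<in> UNIV - {0}. y ^ n = z})"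
    unfolding card_eq_sum by (rule sum.image_gen) simp
  also have "\<dots> \<le> (\<Sum>z\<in>?I. n)" by (rule sum_mono) (rule fib)
  finally have "n * m \<le> n * card ?I" by (simp add: mult.commute)
  then have "m \<le> card ?I" using n by simp
  moreover have "card ?I \<le> card {x::'a. x ^ m = 1}" using sub by (rule card_mono[rotated]) simp
  moreover have "card {x::'a. x ^ m = 1} \<le> m" by (rule card_roots_of_unity_le[OF m])
  ultimately have *: "card {x::'a. x ^ m = 1} = m" "card ?I = m" by linarith+
  show "card {x::'a. x ^ m = 1} = m" by (rule *)
  show "?I = {x. x ^ m = 1}" by (rule card_subset_eq[OF _ sub]) (simp_all only: * finite)
qed

section \<open>The circle, and square roots of subfield elements\<close>

lemma q2_minus_1: "(q - 1) * (q + 1) = q ^ 2 - 1"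
  using q_ge_5 by (cases q) (simp_all add: power2_eq_square)

lemma card_mu: "card mu = q + 1"
  using power_surj_on_roots_of_unity(2)[OF q2_minus_1] by (simp add: mu_def)

lemma hilbert90_mu:
  assumes "x \<in> mu"
  obtains y where "y \<noteq> 0" "y ^ (q - 1) = x"
proof -
  have "x \<in> (\<lambda>y. y ^ (q - 1)) ` (UNIV - {0})"
    using assms by (subst power_surj_on_roots_of_unity(1)[OF q2_minus_1]) (simp add: mu_def)
  then show ?thesis using that by auto
qed

text \<open>Real means fixed by \<open>cj\<close>. A nonzero such \<open>d\<close> has
  \<open>d ^ (q - 1) = 1\<close>, and \<open>q - 1\<close> divides half of \<open>q ^ 2 - 1\<close>
  because \<open>q + 1\<close> is even.\<close>

lemma sqrt_of_real_exists:
  assumes "cj d = d"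
  obtains y where "y ^ 2 = d"
proof (cases "d = 0")
  case False
  have "d * d ^ (q - 1) = d * 1" using assms q_ge_5 by (simp add: cj_eq flip: power_Suc)
  then have "d ^ (q - 1) = 1" using False by simp
  then have "d ^ ((q - 1) * ((q + 1) div 2)) = 1" by (simp add: power_mult)
  moreover have "2 * ((q - 1) * ((q + 1) div 2)) = q ^ 2 - 1"
    unfolding q2_minus_1[symmetric] using odd_q
    by (metis dvd_mult_div_cancel even_plus_one_iff mult.left_commute)
  ultimately have "d \<in> (\<lambda>y. y ^ 2) ` (UNIV - {0})"
    by (subst power_surj_on_roots_of_unity(1)) auto
  then show ?thesis using that by blast
qed (use that[of 0] in simp)

lemma nonzero_squares_iff: "d \<in> nonzero_squares_Fq q \<longleftrightarrow> (\<exists>y. cj y = y \<and> y \<noteq> 0 \<and> d = y ^ 2)"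
  by (simp add: nonzero_squares_Fq_def cj_eq)

text \<open>Conjugation fixes or negates a square root of \<open>d\<close>; a nonzero fixed root
  would make \<open>d\<close> a nonzero square. The value \<open>d = 0\<close> is included, with
  root 0.\<close>

lemma sqrt_of_nonsquare:
  assumes "cj d = d" "d \<notin> nonzero_squares_Fq q"
  obtains y where "y ^ 2 = d" "cj y = - y"
proof -
  obtain y where y: "y ^ 2 = d" using sqrt_of_real_exists[OF assms(1)] .
  have "cj y ^ 2 = y ^ 2" using y assms(1) by (metis cj_power)
  then have "cj y = y \<or> cj y = - y" by (simp add: power2_eq_iff)
  moreover have "cj y = y \<Longrightarrow> y = 0" using assms(2) y by (auto simp: nonzero_squares_iff)
  ultimately have "cj y = - y" by auto
  then show ?thesis using that y by blast
qed

section \<open>Polynomials vanishing on the circle\<close>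

lemma poly_eq_0_if_zero_on_mu:
  assumes "\<And>x. x \<in> mu \<Longrightarrow> poly f x = 0" "degree f \<le> q"
  shows "f = 0"
  by (rule poly_eqI_degree[of mu]) (use assms card_mu in auto)

lemma mu_dvd_if_zero_on_mu:
  assumes "\<And>x. x \<in> mu \<Longrightarrow> poly f x = 0"
  obtains g where "f = (monom 1 (q + 1) - 1) * g"
proof -
  let ?M = "monom 1 (q + 1) - 1 :: 'a poly"
  have deg: "degree ?M = q + 1" by (rule degree_monom_minus_1) simp
  then have "?M \<noteq> 0" by auto
  then have "degree (f mod ?M) \<le> q" using degree_mod_less[of ?M f] deg by auto
  moreover have "poly (f mod ?M) x = 0" if "x \<in> mu" for x
  proof -
    have "poly f x = poly (?M * (f div ?M) + f mod ?M) x" by simp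
    then show ?thesis using assms[OF that] that unfolding poly_add poly_mult
      by (simp add: poly_monom mu_def)
  qed
  ultimately have "f mod ?M = 0" by (intro poly_eq_0_if_zero_on_mu)
  then show ?thesis using that by (metis dvd_def mod_0_imp_dvd)
qed

end

section \<open>Quartics that are squares on the circle\<close>

text \<open>The Euler operator. Unlike \<open>pderiv\<close> it keeps the circle polynomial
  manageable: in characteristic \<open>p\<close> it sends \<open>M = x ^ (q + 1) - 1\<close> to
  \<open>M + 1\<close>.\<close>

definition theta :: "'a::idom poly \<Rightarrow> 'a poly" where
  "theta f = [:0, 1:] * pderiv f"

lemma theta_add: "theta (f + g) = theta f + theta g"
  and theta_diff: "theta (f - g) = theta f - theta g"
  and theta_mult: "theta (f * g) = theta f * g + f * theta g"
  and theta_1 [simp]: "theta 1 = 0"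
  and theta_numeral [simp]: "theta (numeral n) = 0"
  by (simp_all add: theta_def pderiv_add pderiv_diff pderiv_mult numeral_poly algebra_simps)

lemma degree_theta_le: "degree (theta f) \<le> degree f"
proof (cases "pderiv f = 0")
  case False
  have "degree (pderiv f) \<le> degree f - 1"
    by (rule degree_le) (auto simp: coeff_pderiv coeff_eq_0)
  moreover have "degree f \<noteq> 0" using False by (metis degree_eq_zeroE pderiv_singleton)
  ultimately show ?thesis by (auto simp: theta_def)
qed (simp add: theta_def)

text \<open>A suffix \<open>d\<close> stands for one application of \<open>theta\<close>; hypothesis
  \<open>d\<close> is \<open>theta\<close> of \<open>e\<close>, computed with
  \<open>theta M = M + 1\<close>. The point is that \<open>Q\<close> and \<open>Qd\<close> drop out
  except through \<open>R\<close>, which has small degree.\<close>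

lemma stepanov_elimination:
  fixes P Pd Pdd Q Qd R Rd M :: "'a::comm_ring_1"
  assumes R: "R = (2 * P - Pd) * Q - 2 * P * Qd"
    and e: "2 * P * Q - 4 * P + Pd = M * R"
    and d: "2 * Pd * Q + 2 * P * Qd - 4 * Pd + Pdd = (M + 1) * R + M * Rd"
  shows "M * (Pd * R - 2 * P * Rd) = 4 * P * R - (8 * P * P - 6 * P * Pd - Pd * Pd + 2 * P * Pdd)"
proof -
  have d': "M * Rd = 2 * Pd * Q + 2 * P * Qd - 4 * Pd + Pdd - (2 * P * Q - 4 * P + Pd) - R"
    unfolding d e by (simp add: algebra_simps)
  have "M * (Pd * R - 2 * P * Rd) = Pd * (M * R) - 2 * P * (M * Rd)" by (simp add: algebra_simps)
  also have "\<dots> = Pd * (2 * P * Q - 4 * P + Pd) - 2 * P * (2 * Pd * Q + 2 * P * Qd - 4 * Pd + Pdd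
      - (2 * P * Q - 4 * P + Pd) - R)"
    by (simp only: d' e)
  also have "\<dots> = 4 * P * R - (8 * P * P - 6 * P * Pd - Pd * Pd + 2 * P * Pdd)"
    unfolding R by (simp add: algebra_simps)
  finally show ?thesis .
qed

text \<open>The terms of degree 8 and 7 cancel, which brings the degree down to 6.\<close>

lemma quartic_covariant:
  fixes p0 p1 p2 p3 p4 :: "'a::idom"
  defines "P \<equiv> [:p0, p1, p2, p3, p4:]"
  shows "8 * P * P - 6 * P * theta P - theta P * theta P + 2 * P * theta (theta P) =
    [:8 * (p0 * p0), 12 * (p0 * p1), 12 * (p0 * p2) + 3 * (p1 * p1), 16 * (p0 * p3) + 4 * (p1 * p2),
      24 * (p0 * p4) + 6 * (p1 * p3), 12 * (p1 * p4), 4 * (p2 * p4) - p3 * p3:]"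
  unfolding P_def theta_def by (simp add: pderiv_pCons numeral_poly algebra_simps)

text \<open>This is \<open>R ^ 3\<close> times \<open>theta\<close> of the quotient
  \<open>P / R ^ 2\<close>, so its vanishing should make \<open>P\<close> a constant multiple of
  \<open>R ^ 2\<close>.\<close>

lemma quartic_jacobian:
  fixes p0 p1 p2 p3 p4 r0 r1 r2 :: "'a::idom"
  defines "P \<equiv> [:p0, p1, p2, p3, p4:]" and "R \<equiv> [:r0, r1, r2:]"
  shows "theta P * R - 2 * P * theta R =
    [:0, p1 * r0 - 2 * (p0 * r1), 2 * (p2 * r0) - p1 * r1 - 4 * (p0 * r2), 3 * (p3 * r0) - 3 * (p1 * r2),
      p3 * r1 + 4 * (p4 * r0) - 2 * (p2 * r2), 2 * (p4 * r1) - p3 * r2:]"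
  unfolding P_def R_def theta_def by (simp add: pderiv_pCons numeral_poly algebra_simps)

lemma degree_le_2E:
  assumes "degree f \<le> 2"
  obtains r0 r1 r2 where "f = [:r0, r1, r2:]"
proof -
  have "f = [:coeff f 0, coeff f 1, coeff f 2:]"
  proof (rule poly_eqI)
    fix n show "coeff f n = coeff [:coeff f 0, coeff f 1, coeff f 2:] n"
      using assms by (cases "n \<le> 2") (auto simp: coeff_eq_0 coeff_pCons le_Suc_eq numeral_2_eq_2 split: nat.split)
  qed
  then show ?thesis using that by blast
qed

text \<open>
  These two equations hold whenever the quartic with coefficients \<open>p0, \<dots>, p4\<close> is a constant times a
  square; they are all that is needed of that property.
\<close>

definition square_quartic :: "'a::comm_ring_1 \<Rightarrow> 'a \<Rightarrow> 'a \<Rightarrow> 'a \<Rightarrow> 'a \<Rightarrow> bool" where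
  "square_quartic p0 p1 p2 p3 p4 \<longleftrightarrow>
     p3 ^ 2 * p0 = p1 ^ 2 * p4 \<and> p3 ^ 3 + 8 * p4 ^ 2 * p1 = 4 * p4 * p3 * p2"

lemma square_quartic_smult_square:
  "square_quartic (c * r0 ^ 2) (2 * c * r0 * r1) (c * (r1 ^ 2 + 2 * r0 * r2)) (2 * c * r1 * r2) (c * r2 ^ 2)"
  unfolding square_quartic_def by (simp add: algebra_simps power2_eq_square power3_eq_cube)

text \<open>Such a quartic need not be a constant times a square, but it satisfies the two
  equations, which settles the degenerate cases.\<close>

lemma square_quartic_x2: "square_quartic p0 0 p2 0 p4"
  unfolding square_quartic_def by simp

text \<open>If \<open>r2\<close> is nonzero, comparing coefficients from the top gives
  \<open>P = c R ^ 2\<close>. Otherwise \<open>p3 = 0\<close>, then \<open>p1 = 0\<close> by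
  \<open>sym\<close>, and \<open>square_quartic_x2\<close> applies; only for \<open>R = 0\<close>
  does this need \<open>cov\<close>.\<close>

lemma quartic_square_if_jacobian_0:
  fixes p0 p1 p2 p3 p4 r0 r1 r2 :: "'a::field"
  defines "P \<equiv> [:p0, p1, p2, p3, p4:]" and "R \<equiv> [:r0, r1, r2:]"
  assumes two: "(2::'a) \<noteq> 0" and three: "(3::'a) \<noteq> 0"
    and sym: "p0 = 0 \<longleftrightarrow> p4 = 0" "p1 = 0 \<longleftrightarrow> p3 = 0"
    and jac: "theta P * R = 2 * P * theta R"
    and cov: "4 * P * R = 8 * P * P - 6 * P * theta P - theta P * theta P + 2 * P * theta (theta P)"
  shows "square_quartic p0 p1 p2 p3 p4"
proof -
  have four: "(4::'a) \<noteq> 0" and eight: "(8::'a) \<noteq> 0"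
    using two by (metis mult_2 mult_eq_0_iff numeral_Bit0)+
  have "theta P * R - 2 * P * theta R = 0" using jac by simp
  then have j: "2 * (p4 * r1) = p3 * r2" "p3 * r1 + 4 * (p4 * r0) = 2 * (p2 * r2)"
    "p3 * r0 = p1 * r2" "2 * (p2 * r0) = p1 * r1 + 4 * (p0 * r2)" "p1 * r0 = 2 * (p0 * r1)"
    using three unfolding P_def R_def quartic_jacobian by (auto simp: algebra_simps)
  consider "r2 \<noteq> 0" | "r2 = 0" "r1 \<noteq> 0" | "r2 = 0" "r1 = 0" "r0 \<noteq> 0" | "r2 = 0" "r1 = 0" "r0 = 0"
    by blast
  then show ?thesis
  proof cases
    case 1
    define c where "c = p4 / r2 ^ 2"
    have 4: "p4 = c * r2 ^ 2" using 1 by (simp add: c_def)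
    have "p3 * r2 = (2 * c * r1 * r2) * r2" unfolding j(1)[symmetric] 4 by (simp add: algebra_simps power2_eq_square)
    then have 3: "p3 = 2 * c * r1 * r2" using 1 by simp
    have "(2 * r2) * p2 = (2 * r2) * (c * (r1 ^ 2 + 2 * r0 * r2))"
      using j(2) unfolding 3 4 by (simp add: algebra_simps power2_eq_square)
    then have 2: "p2 = c * (r1 ^ 2 + 2 * r0 * r2)" using 1 two by simp
    have "p1 * r2 = (2 * c * r0 * r1) * r2" unfolding j(3)[symmetric] 3 by (simp add: algebra_simps)
    then have p1: "p1 = 2 * c * r0 * r1" using 1 by simp
    have "4 * (p0 * r2) = 2 * (p2 * r0) - p1 * r1" using j(4) by simp
    also have "\<dots> = 4 * ((c * r0 ^ 2) * r2)" unfolding p1 2 by (simp add: algebra_simps power2_eq_square)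
    finally have "(4 * r2) * p0 = (4 * r2) * (c * r0 ^ 2)" by (simp only: ac_simps)
    then have p0: "p0 = c * r0 ^ 2" using 1 four by simp
    show ?thesis unfolding p0 p1 2 3 4 by (rule square_quartic_smult_square)
  next
    case 2
    then have "p4 = 0" "p3 = 0" using j two by auto
    then show ?thesis using sym by (simp add: square_quartic_x2)
  next
    case 3
    then have "p3 = 0" using j by auto
    then show ?thesis using sym by (simp add: square_quartic_x2)
  next
    case 4
    then have "R = 0" by (simp add: R_def)
    then have "8 * P * P - 6 * P * theta P - theta P * theta P + 2 * P * theta (theta P) = 0"
      using cov by simp
    then have s: "8 * (p0 * p0) = 0" "4 * (p2 * p4) - p3 * p3 = 0"
      unfolding P_def quartic_covariant by simp_all
    then have "p4 = 0" using eight sym by auto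
    then have "p3 = 0" using s by simp
    then show ?thesis using sym by (simp add: square_quartic_x2)
  qed
qed

section \<open>Stepanov's method on the circle\<close>

context quadratic_ext
begin

text \<open>The exponent \<open>(q - 1) div 2\<close> equals -1/2 in the field, so \<open>E\<close>
  differentiates like \<open>x ^ 2\<close> divided by a square root of \<open>P\<close>.\<close>

lemma theta_half_power:
  assumes "E = [:0, 1:] ^ 2 * P ^ ((q - 1) div 2)"
  shows "2 * P * theta E = (4 * P - theta P) * (E :: 'a poly)"
proof -
  define n where "n = (q - 1) div 2"
  have n: "2 * n + 1 = q" and n0: "n = Suc (n - 1)" using odd_q q_ge_5 by (auto simp: n_def elim!: oddE)
  have "2 * of_nat n + 1 = (0::'a)" using of_nat_q n by (metis of_nat_1 of_nat_add of_nat_mult of_nat_numeral)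
  then have "[:2 * of_nat n + 1:] = (0::'a poly)" by simp
  then have nn: "2 * of_nat n = (- 1 :: 'a poly)"
    by (simp add: of_nat_poly numeral_poly eq_neg_iff_add_eq_0 one_pCons mult.commute)
  have X: "theta ([:0, 1:] ^ 2) = 2 * [:0, 1::'a:] ^ 2"
    by (simp add: theta_def power2_eq_square pderiv_pCons numeral_poly)
  have "theta (P ^ n) = of_nat n * P ^ (n - 1) * theta P"
    unfolding theta_def pderiv_power by (simp add: of_nat_poly algebra_simps)
  moreover have "P * P ^ (n - 1) = P ^ n" using n0 by (metis power_Suc)
  ultimately have "2 * P * theta (P ^ n) = (2 * of_nat n) * P ^ n * theta P"
    by (simp add: algebra_simps)
  then have "2 * P * theta (P ^ n) = - (P ^ n * theta P)" by (simp add: nn)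
  moreover have "theta E = 2 * E + [:0, 1:] ^ 2 * theta (P ^ n)"
    unfolding assms theta_mult X n_def by (simp add: mult.assoc)
  moreover have "2 * P * ([:0, 1:] ^ 2 * theta (P ^ n)) = [:0, 1:] ^ 2 * (2 * P * theta (P ^ n))"
    by (simp only: ac_simps)
  ultimately have "2 * P * theta E = 4 * P * E - [:0, 1:] ^ 2 * (P ^ n * theta P)"
    by (simp add: distrib_left)
  then show ?thesis unfolding assms n_def by (simp add: algebra_simps)
qed

text \<open>
  With \<open>M = x ^ (q + 1) - 1\<close> the hypothesis reads \<open>x\<^sup>2 P ^ ((q - 1) div 2) = 1 + M Q\<close>. Differentiating twice
  and eliminating \<open>Q\<close> shows that \<open>M\<close> divides a polynomial of degree at most 6, which is therefore 0.
  This needs \<open>q + 1 > 6\<close>, so \<open>q = 5\<close> has to be treated separately.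
\<close>

lemma stepanov_quartic:
  fixes p0 p1 p2 p3 p4 :: 'a
  defines "P \<equiv> [:p0, p1, p2, p3, p4:]"
  assumes q: "q \<ge> 7"
    and sym: "p0 = 0 \<longleftrightarrow> p4 = 0" "p1 = 0 \<longleftrightarrow> p3 = 0"
    and one: "\<And>x. x \<in> mu \<Longrightarrow> x ^ 2 * poly P x ^ ((q - 1) div 2) = 1"
  shows "square_quartic p0 p1 p2 p3 p4"
proof -
  define E where "E = [:0, 1:] ^ 2 * P ^ ((q - 1) div 2)"
  define M where "M = (monom 1 (q + 1) - 1 :: 'a poly)"
  have degM: "degree M = q + 1" unfolding M_def by (rule degree_monom_minus_1) simp
  then have M0: "M \<noteq> 0" by auto
  have "poly (E - 1) x = 0" if "x \<in> mu" for x using one[OF that] by (simp add: E_def)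
  then obtain Q where "E - 1 = M * Q" unfolding M_def by (rule mu_dvd_if_zero_on_mu)
  then have E: "E = 1 + M * Q" by (simp add: algebra_simps)
  have degP: "degree P \<le> 4" unfolding P_def by simp
  have degQ: "degree Q \<le> q - 1"
  proof (cases "Q = 0")
    case False
    have "degree (P ^ ((q - 1) div 2)) \<le> 4 * ((q - 1) div 2)"
      using degree_power_le[of P "(q - 1) div 2"] degP by (meson le_trans mult_le_mono1)
    then have "degree (P ^ ((q - 1) div 2)) \<le> 2 * (q - 1)" using odd_q by (auto elim!: oddE)
    moreover have "degree ([:0, 1::'a:] ^ 2) = 2" by (simp add: power2_eq_square)
    ultimately have "degree E \<le> 2 * q"
      using degree_mult_le[of "[:0, 1::'a:] ^ 2" "P ^ ((q - 1) div 2)"] q unfolding E_def by linarith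
    then have "degree (M * Q) \<le> 2 * q"
      using degree_diff_le[of E "2 * q" 1] by (simp add: E)
    then show ?thesis using False M0 degM by (simp add: degree_mult_eq)
  qed simp
  have "pderiv M = monom 1 q" by (simp add: M_def pderiv_diff pderiv_monom of_nat_q)
  then have thM: "theta M = M + 1" by (simp add: theta_def M_def monom_Suc)
  \<comment> \<open>\<open>R\<close> is the cofactor of \<open>M\<close> once the terms of the
    differential equation for \<open>E\<close> that are free of \<open>M\<close> are collected on
    one side.\<close>
  define R where "R = (2 * P - theta P) * Q - 2 * P * theta Q"
  have "2 * P * theta E = (4 * P - theta P) * E" by (rule theta_half_power[OF E_def])
  then have "2 * P * ((M + 1) * Q + M * theta Q) = (4 * P - theta P) * (1 + M * Q)"
    by (simp add: E theta_add theta_mult thM)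
  then have e: "2 * P * Q - 4 * P + theta P = M * R" unfolding R_def by algebra
  then have "theta (2 * P * Q - 4 * P + theta P) = theta (M * R)" by simp
  then have "2 * theta P * Q + 2 * P * theta Q - 4 * theta P + theta (theta P) = (M + 1) * R + M * theta R"
    by (simp add: theta_add theta_diff theta_mult thM)
  note main = stepanov_elimination[OF R_def e this]
  have degR: "degree R \<le> 2"
  proof (cases "R = 0")
    case False
    have "degree (2 * P * Q) \<le> q + 3"
      using degree_mult_le[of "2 * P" Q] degree_mult_le[of 2 P] degP degQ q by simp
    moreover have "degree (4 * P) \<le> q + 3"
      using degree_mult_le[of 4 P] degP q by simp
    moreover have "degree (theta P) \<le> q + 3" using degree_theta_le[of P] degP q by simp
    ultimately have "degree (M * R) \<le> q + 3" unfolding e[symmetric] by (intro degree_add_le degree_diff_le)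
    then show ?thesis using False M0 degM by (simp add: degree_mult_eq)
  qed simp
  then obtain r0 r1 r2 where R: "R = [:r0, r1, r2:]" by (rule degree_le_2E)
  have "theta P * R - 2 * P * theta R = 0" (is "?W = 0")
  proof (rule ccontr)
    assume "?W \<noteq> 0"
    then have "degree (M * ?W) \<ge> 8" using M0 degM q by (simp add: degree_mult_eq)
    moreover have "degree (4 * P * R) \<le> 6"
      using degree_mult_le[of "4 * P" R] degree_mult_le[of 4 P] degP degR by simp
    moreover have "degree (8 * P * P - 6 * P * theta P - theta P * theta P + 2 * P * theta (theta P)) \<le> 6"
      unfolding P_def quartic_covariant by simp
    ultimately show False unfolding main using degree_diff_le[of "4 * P * R" 6] by fastforce
  qed
  moreover from this have "4 * P * R = 8 * P * P - 6 * P * theta P - theta P * theta P + 2 * P * theta (theta P)"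
    using main by simp
  ultimately show ?thesis using quartic_square_if_jacobian_0[OF _ _ sym] unfolding P_def R by simp
qed

text \<open>Here the power of \<open>P\<close> is just its square, so the hypothesis is a set of
  explicit equations between the coefficients, solved by hand in characteristic 5.\<close>

lemma quartic_q_eq_5:
  fixes p0 p1 p2 p3 p4 :: 'a
  assumes q: "q = 5"
    and sym: "cj p4 = p0" "cj p3 = p1" "cj p2 = p2"
    and one: "\<And>x. x \<in> mu \<Longrightarrow> x ^ 2 * poly [:p0, p1, p2, p3, p4:] x ^ 2 = 1"
  shows "square_quartic p0 p1 p2 p3 p4"
proof (cases "p3 = 0")
  case True
  then show ?thesis using sym by (auto simp: square_quartic_x2)
next
  case False
  have five: "(5::'a) = 0" using of_nat_q q by simp
  \<comment> \<open>reduction of \<open>x\<^sup>2 P(x)\<^sup>2 - 1\<close> modulo \<open>x\<^sup>6 - 1\<close>\<close>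
  define G where "G = [:2 * p0 * p4 + 2 * p1 * p3 + p2 ^ 2 - 1, 2 * p1 * p4 + 2 * p2 * p3,
    p0 ^ 2 + 2 * p2 * p4 + p3 ^ 2, 2 * p0 * p1 + 2 * p3 * p4, 2 * p0 * p2 + p1 ^ 2 + p4 ^ 2,
    2 * p0 * p3 + 2 * p1 * p2:]"
  have "G = 0"
  proof (rule poly_eq_0_if_zero_on_mu)
    fix x assume x: "x \<in> mu"
    then have "x ^ 6 = 1" unfolding mu_def by (simp add: q)
    moreover have "poly G x = (x ^ 2 * poly [:p0, p1, p2, p3, p4:] x ^ 2 - 1) - (x ^ 6 - 1) *
      ((2 * p2 * p4 + p3 ^ 2) * x ^ 2 + 2 * p3 * p4 * x ^ 3 + p4 ^ 2 * x ^ 4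
       + (2 * p1 * p4 + 2 * p2 * p3) * x + (2 * p0 * p4 + 2 * p1 * p3 + p2 ^ 2))"
      unfolding G_def by (simp add: algebra_simps power_def numeral_eq_Suc)
    ultimately show "poly G x = 0" using one[OF x] by simp
  next
    show "degree G \<le> q" unfolding G_def q by simp
  qed
  then have "2 * (p1 * p4 + p2 * p3) = 0" and c: "p0 ^ 2 + 2 * p2 * p4 + p3 ^ 2 = 0"
    and "2 * (p0 * p1 + p3 * p4) = 0" unfolding G_def by (simp_all add: algebra_simps)
  then have a: "p1 * p4 = - (p2 * p3)" and b: "p0 * p1 = - (p3 * p4)"
    unfolding eq_neg_iff_add_eq_0 mult_eq_0_iff by simp_all
  \<comment> \<open>Conjugation exchanges \<open>p0\<close> with \<open>p4\<close> and
    \<open>p1\<close> with \<open>p3\<close>.\<close>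
  have "cj (p1 * p4) = cj (- (p2 * p3))" by (simp only: a)
  then have a': "p0 * p3 = - (p1 * p2)" using sym by (auto simp: ac_simps)
  have "p1 \<noteq> 0" using False sym by auto
  have "p2 * (p1 ^ 3 + p3 ^ 3) = 0"
    using a a' b by algebra
  then have "p2 * (p2 * p1 ^ 2 - p4 * p3 ^ 2) * p1 = 0" using a by algebra
  then have "p2 * (p2 * p1 ^ 2 - p4 * p3 ^ 2) = 0" using \<open>p1 \<noteq> 0\<close> by simp
  then have "(p0 ^ 2 - p2 * p4) * p3 ^ 2 = 0" using a' by algebra
  then have d: "p0 ^ 2 - p2 * p4 = 0" using False by simp
  \<comment> \<open>Replacing \<open>p1 * p4\<close> by \<open>a\<close> and cancelling
    \<open>p3\<close> turns the second equation of \<open>square_quartic\<close> into this.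
    Subtracting \<open>d\<close> from \<open>c\<close> gives the factor -3, which is 12 modulo
    5.\<close>
  have p3: "p3 ^ 2 = 12 * p2 * p4"
  proof -
    have "p3 ^ 2 - 12 * p2 * p4 = (p0 ^ 2 + 2 * p2 * p4 + p3 ^ 2) - (p0 ^ 2 - p2 * p4) - 5 * (3 * p2 * p4)"
      by (simp add: algebra_simps)
    then have "p3 ^ 2 - 12 * p2 * p4 = 0" by (simp only: c d five) simp
    then show ?thesis by simp
  qed
  have "p3 ^ 2 * p0 = p1 ^ 2 * p4" using a a' by algebra
  moreover have "p3 ^ 3 + 8 * p4 ^ 2 * p1 = 4 * p4 * p3 * p2" using p3 a by algebra
  ultimately show ?thesis by (simp add: square_quartic_def)
qed

text \<open>
  Counting zeros gives \<open>(x - x0) K ^ n = x0\<^sup>2 (x - x0) ^ q\<close> with \<open>n = (q - 1) div 2\<close>, so \<open>K\<close> is a constant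
  times \<open>(x - x0)\<^sup>2\<close>.
\<close>

lemma quadratic_if_single_zero:
  fixes c0 c1 c2 x0 :: 'a
  defines "K \<equiv> [:c0, c1, c2:]"
  assumes x0: "x0 \<in> mu"
    and eq: "\<And>x. x \<in> mu \<Longrightarrow> x \<noteq> x0 \<Longrightarrow> (x - x0) ^ (q - 1) * poly K x ^ ((q - 1) div 2) = x ^ (q - 1)"
  shows "c0 + c1 * x0 + c2 * x0 ^ 2 = 0" "c1 + 2 * c2 * x0 = 0"
proof -
  define n where "n = (q - 1) div 2"
  have n: "q - 1 = 2 * n" "n > 0" using odd_q q_ge_5 by (auto simp: n_def elim!: oddE)
  have x00: "x0 \<noteq> 0" using x0 by (rule mu_nonzero)
  let ?L = "[:- x0, 1:]" and ?M = "monom 1 (q + 1) - 1 :: 'a poly"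
  \<comment> \<open>On the circle \<open>x ^ (q - 1)\<close> is \<open>1 / x ^ 2\<close> and
    \<open>(x - x0) ^ (q - 1)\<close> is \<open>- 1 / (x * x0)\<close>, so \<open>eq\<close> becomes
    \<open>x * K ^ n + x0 = 0\<close>. The factor \<open>?L\<close> supplies the missing point
    \<open>x0\<close>; as the degree is at most \<open>q + 1\<close>, \<open>F\<close> is a constant
    multiple of \<open>?M\<close>.\<close>
  define F where "F = ?L * ([:0, 1:] * K ^ n + [:x0:])"
  have "poly F x = 0" if x: "x \<in> mu" for x
  proof (cases "x = x0")
    case False
    have xn: "x \<noteq> 0" using x by (rule mu_nonzero)
    have "x * x ^ (q - 1) = cj x" using q_ge_5 by (simp add: cj_eq flip: power_Suc)
    then have 1: "x ^ (q - 1) = 1 / x ^ 2" using cj_mu[OF x] xn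
      by (simp add: power2_eq_square field_simps)
    have "(x - x0) * (x - x0) ^ (q - 1) = cj (x - x0)" using q_ge_5 by (simp add: cj_eq flip: power_Suc)
    also have "\<dots> = (x - x0) * (- 1 / (x * x0))" using cj_mu[OF x] cj_mu[OF x0] xn x00
      by (simp add: field_simps)
    finally have 2: "(x - x0) ^ (q - 1) = - 1 / (x * x0)" using False by (metis mult_left_cancel right_minus_eq)
    have "- 1 / (x * x0) * poly K x ^ n = 1 / x ^ 2"
      using eq[OF x False] by (simp only: 1 2 n_def)
    then have "x0 = - (x * poly K x ^ n)" using xn x00 by (simp add: field_simps power2_eq_square)
    then have "x * poly K x ^ n + x0 = 0" by simp
    moreover have "poly F x = (x - x0) * (x * poly K x ^ n + x0)" by (simp add: F_def algebra_simps)
    ultimately show ?thesis by simp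
  qed (simp add: F_def)
  then obtain g where g: "F = ?M * g" by (rule mu_dvd_if_zero_on_mu)
  have degM: "degree ?M = q + 1" by (rule degree_monom_minus_1) simp
  have "degree F \<le> q + 1"
  proof -
    have "degree K \<le> 2" unfolding K_def by simp
    then have "degree (K ^ n) \<le> 2 * n"
      using degree_power_le[of K n] by (meson le_trans mult_le_mono1)
    then have "degree ([:0, 1:] * K ^ n) \<le> q"
      using degree_mult_le[of "[:0, 1:]" "K ^ n"] n q_ge_5 by simp
    then have "degree ([:0, 1:] * K ^ n + [:x0:]) \<le> q" by (intro degree_add_le) simp_all
    then show ?thesis unfolding F_def using degree_mult_le[of ?L "[:0, 1:] * K ^ n + [:x0:]"] by simp
  qed
  moreover have "degree F = q + 1 + degree g" if "g \<noteq> 0"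
    unfolding g using degM that by (subst degree_mult_eq) auto
  ultimately have "degree g = 0" by (cases "g = 0") auto
  then obtain g0 where g0: "g = [:g0:]" by (rule degree_eq_zeroE)
  have "poly F 0 = - g0" unfolding g g0 by (simp add: poly_monom)
  then have "g0 = x0 ^ 2" by (simp add: F_def power2_eq_square)
  then have F: "F = smult (x0 ^ 2) ?M" unfolding g g0 by simp
  have "of_nat p = (0 :: 'a poly)" by (simp add: of_nat_poly of_nat_p)
  then have "([:- x0:] + monom 1 1) ^ q = [:- x0:] ^ q + monom 1 1 ^ q"
    unfolding q_eq by (rule add_power_prime_power_of_nat_0[OF prime_p])
  moreover have "[:- x0:] + monom 1 1 = ?L" by (simp add: monom_altdef)
  moreover have "[:- x0:] ^ q = [:- (1 / x0):]"
    using cj_mu[OF x0] odd_q by (simp add: cj_eq poly_const_pow)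
  ultimately have Lq: "?L ^ q = [:- (1 / x0):] + monom 1 q" by (simp add: monom_power)
  have "?L * ([:0, 1:] * K ^ n) = F - smult x0 ?L" unfolding F_def by (simp add: algebra_simps)
  also have "\<dots> = [:0, 1:] * smult (x0 ^ 2) (?L ^ q)"
    unfolding F Lq using x00
    by (simp add: monom_Suc smult_diff_right power2_eq_square smult_monom one_pCons smult_add_right)
  finally have "[:0, 1:] * (?L * K ^ n) = [:0, 1:] * smult (x0 ^ 2) (?L ^ q)"
    by (simp only: ac_simps)
  then have "?L * K ^ n = smult (x0 ^ 2) (?L ^ q)" by (subst (asm) mult_cancel_left) simp
  also have "\<dots> = ?L * smult (x0 ^ 2) (?L ^ (2 * n))" using n q_ge_5
    by (metis (no_types, lifting) Suc_pred' less_le_trans mult_smult_right power_Suc zero_less_numeral)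
  finally have Kn: "K ^ n = smult (x0 ^ 2) (?L ^ (2 * n))" by (subst (asm) mult_cancel_left) simp
  \<comment> \<open>Evaluating at \<open>x0\<close> gives a first root of \<open>K\<close>; after
    cancelling \<open>?L ^ n\<close> the same evaluation gives it a second time.\<close>
  then have "poly (K ^ n) x0 = 0" using n by simp
  then show 0: "c0 + c1 * x0 + c2 * x0 ^ 2 = 0" using n by (simp add: K_def algebra_simps power2_eq_square)
  then have c0: "c0 = - (x0 * (c1 + c2 * x0))" by (simp add: algebra_simps power2_eq_square eq_neg_iff_add_eq_0)
  have K: "K = ?L * [:c1 + c2 * x0, c2:]" unfolding K_def c0 by (simp add: algebra_simps)
  have "?L ^ n * [:c1 + c2 * x0, c2:] ^ n = K ^ n" by (simp only: K power_mult_distrib)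
  also have "\<dots> = ?L ^ n * smult (x0 ^ 2) (?L ^ n)" unfolding Kn by (simp add: mult_2 power_add)
  finally have "?L ^ n * [:c1 + c2 * x0, c2:] ^ n = ?L ^ n * smult (x0 ^ 2) (?L ^ n)" .
  then have "[:c1 + c2 * x0, c2:] ^ n = smult (x0 ^ 2) (?L ^ n)" by (subst (asm) mult_cancel_left) simp
  then have "poly ([:c1 + c2 * x0, c2:] ^ n) x0 = 0" using n by simp
  then show "c1 + 2 * c2 * x0 = 0" using n by (simp add: algebra_simps)
qed

text \<open>The split is by double zeros of \<open>P\<close> on the circle: with none, the Stepanov
  argument or the case \<open>q = 5\<close> applies; with exactly one,
  \<open>quadratic_if_single_zero\<close> handles the quotient; with two, the quotient has a double
  root at once.\<close>

lemma quartic_square_if_squares_on_mu: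
  fixes p0 p1 p2 p3 p4 :: 'a
  defines "P \<equiv> [:p0, p1, p2, p3, p4:]"
  assumes sym: "cj p4 = p0" "cj p3 = p1" "cj p2 = p2"
    and H: "\<And>x. x \<in> mu \<Longrightarrow> poly P x / x ^ 2 \<in> nonzero_squares_Fq q \<or>
              poly P x = 0 \<and> poly (pderiv P) x = 0"
  shows "square_quartic p0 p1 p2 p3 p4"
proof -
  have sq: "poly P x ^ ((q - 1) div 2) = x ^ (q - 1)"
    if x: "x \<in> mu" and s: "poly P x / x ^ 2 \<in> nonzero_squares_Fq q" for x
  proof -
    obtain y where y: "y ^ q = y" "y \<noteq> 0" "poly P x / x ^ 2 = y ^ 2"
      using s by (auto simp: nonzero_squares_Fq_def)
    have "y * y ^ (q - 1) = y * 1" using y q_ge_5 by (simp flip: power_Suc)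
    then have 1: "y ^ (q - 1) = 1" using y by simp
    have "poly P x = (y * x) ^ 2" using y(3) mu_nonzero[OF x] by (simp add: field_simps)
    then have "poly P x ^ ((q - 1) div 2) = (y * x) ^ (2 * ((q - 1) div 2))" by (simp only: power_mult)
    also have "2 * ((q - 1) div 2) = q - 1" using odd_q by (auto elim!: oddE)
    finally show ?thesis using 1 by (simp add: power_mult_distrib)
  qed
  show ?thesis
  proof (cases "\<exists>x\<in>mu. poly P x = 0 \<and> poly (pderiv P) x = 0")
    case False
    have one: "x ^ 2 * poly P x ^ ((q - 1) div 2) = 1" if x: "x \<in> mu" for x
    proof -
      have "poly P x ^ ((q - 1) div 2) = x ^ (q - 1)" using sq[OF x] H[OF x] False x by blast
      moreover have "x ^ 2 * x ^ (q - 1) = x ^ (q + 1)" using q_ge_5 by (simp flip: power_add)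
      ultimately show ?thesis using x by (simp add: mu_def)
    qed
    show ?thesis
    proof (cases "q = 5")
      case True
      then show ?thesis using one sym unfolding P_def by (intro quartic_q_eq_5) auto
    next
      case False
      then show ?thesis using one sym q_cases unfolding P_def by (intro stepanov_quartic) auto
    qed
  next
    case True
    then obtain x0 where x0: "x0 \<in> mu" "poly P x0 = 0" "poly (pderiv P) x0 = 0" by blast
    \<comment> \<open>The quotient of \<open>P\<close> by \<open>(x - x0) ^ 2\<close> is
      \<open>c0 + c1 x + p4 x ^ 2\<close>.\<close>
    define c0 c1 where "c0 = p2 + 2 * p3 * x0 + 3 * p4 * x0 ^ 2" and "c1 = p3 + 2 * p4 * x0"
    have d: "p1 + 2 * p2 * x0 + 3 * p3 * x0 ^ 2 + 4 * p4 * x0 ^ 3 = 0"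
      using x0(3) unfolding P_def by (simp add: pderiv_pCons algebra_simps power2_eq_square power3_eq_cube)
    have "p0 + p1 * x0 + p2 * x0 ^ 2 + p3 * x0 ^ 3 + p4 * x0 ^ 4 = 0"
      using x0(2) unfolding P_def by (simp add: algebra_simps power2_eq_square power3_eq_cube power4_eq_xxxx)
    with d have co: "p3 = c1 - 2 * p4 * x0" "p2 = c0 - 2 * c1 * x0 + p4 * x0 ^ 2"
      "p1 = c1 * x0 ^ 2 - 2 * c0 * x0" "p0 = c0 * x0 ^ 2"
      unfolding c0_def c1_def by algebra+
    have P: "P = [:- x0, 1:] ^ 2 * [:c0, c1, p4:]"
      unfolding P_def co by (simp add: algebra_simps power2_eq_square)
    have "\<exists>x1. c0 + c1 * x1 + p4 * x1 ^ 2 = 0 \<and> c1 + 2 * p4 * x1 = 0"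
    proof (cases "\<exists>x1\<in>mu - {x0}. poly P x1 = 0 \<and> poly (pderiv P) x1 = 0")
      case True
      then obtain x1 where x1: "x1 \<noteq> x0" "poly P x1 = 0" "poly (pderiv P) x1 = 0" by blast
      define K where "K = [:c0, c1, p4:]"
      have PK: "P = [:- x0, 1:] ^ 2 * K" using P by (simp only: K_def)
      have r: "poly K x1 = 0" using x1 by (simp add: PK)
      have "poly (pderiv P) x1 = (x1 - x0) ^ 2 * poly (pderiv K) x1"
        unfolding PK pderiv_mult using r by simp
      then have "poly (pderiv K) x1 = 0" using x1 by simp
      then show ?thesis using r unfolding K_def
        by (intro exI[of _ x1]) (simp add: pderiv_pCons algebra_simps power2_eq_square)
    next
      case False
      have "(x - x0) ^ (q - 1) * poly [:c0, c1, p4:] x ^ ((q - 1) div 2) = x ^ (q - 1)"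
        if x: "x \<in> mu" "x \<noteq> x0" for x
      proof -
        have "poly P x ^ ((q - 1) div 2) = x ^ (q - 1)" using sq[OF x(1)] H[OF x(1)] False x by blast
        moreover have "poly P x = (x - x0) ^ 2 * poly [:c0, c1, p4:] x"
          by (simp add: P algebra_simps)
        moreover have "((x - x0) ^ 2) ^ ((q - 1) div 2) = (x - x0) ^ (q - 1)"
          using odd_q by (auto elim!: oddE simp flip: power_mult)
        ultimately show ?thesis by (simp add: power_mult_distrib)
      qed
      from quadratic_if_single_zero[OF x0(1) this] show ?thesis by blast
    qed
    then obtain x1 where x1: "c0 + c1 * x1 + p4 * x1 ^ 2 = 0" "c1 + 2 * p4 * x1 = 0" by blast
    then have c: "c1 = - (2 * p4 * x1)" "c0 = p4 * x1 ^ 2" by algebra+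
    have "p0 = p4 * (x0 * x1) ^ 2" "p1 = 2 * p4 * (x0 * x1) * (- (x0 + x1))"
      "p2 = p4 * ((- (x0 + x1)) ^ 2 + 2 * (x0 * x1) * 1)" "p3 = 2 * p4 * (- (x0 + x1)) * 1" "p4 = p4 * 1 ^ 2"
      unfolding co c by (simp_all add: algebra_simps power2_eq_square)
    then show ?thesis using square_quartic_smult_square by metis
  qed
qed

end

section \<open>Self-conjugate quadratics\<close>

context quadratic_ext
begin

text \<open>If the discriminant had a nonzero root in the subfield, \<open>w = 2 c z + B\<close>
  would be nonzero and fixed by \<open>cj\<close>. Then \<open>c z\<close> is fixed too, so
  \<open>c z ^ 2 = cj c\<close> on the circle, and \<open>z w\<close> equals the quadratic, which is
  0.\<close>

lemma self_conjugate_quadratic_no_root_in_mu: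
  assumes B: "cj B = B" and z: "z \<in> mu" and root: "c * z ^ 2 + B * z + cj c = 0"
  shows "B ^ 2 - 4 * c * cj c \<notin> nonzero_squares_Fq q"
proof
  assume "B ^ 2 - 4 * c * cj c \<in> nonzero_squares_Fq q"
  then obtain y where y: "cj y = y" "y \<noteq> 0" "B ^ 2 - 4 * c * cj c = y ^ 2"
    by (auto simp: nonzero_squares_iff)
  define w where "w = 2 * c * z + B"
  have "w ^ 2 = y ^ 2" using root y(3) unfolding w_def by algebra
  then have "w = y \<or> w = - y" by (simp add: power2_eq_iff)
  then have w: "cj w = w" "w \<noteq> 0" using y by auto
  have "2 * cj c * cj z = 2 * c * z" using w(1) B by (simp add: w_def)
  moreover have "z * cj z = 1" using z by (simp add: mu_iff)
  ultimately have "2 * (c * z ^ 2) = 2 * cj c" by algebra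
  then have "c * z ^ 2 = cj c" unfolding mult_cancel_left by simp
  moreover have "z * w = c * z ^ 2 + B * z + c * z ^ 2"
    by (simp add: w_def algebra_simps power2_eq_square)
  ultimately have "z * w = 0" using root by simp
  then show False using w mu_nonzero[OF z] by simp
qed

text \<open>The discriminant has a root \<open>y\<close> with \<open>cj y = - y\<close>, and this
  sign puts both roots of the quadratic on the circle. By \<open>uniq\<close> both are 1.\<close>

lemma self_conjugate_quadratic_double_root:
  assumes B: "cj B = B" and ns: "B ^ 2 - 4 * c * cj c \<notin> nonzero_squares_Fq q"
    and uniq: "\<And>z. z \<in> mu \<Longrightarrow> c * z ^ 2 + B * z + cj c = 0 \<Longrightarrow> z = 1"
  shows "B = - 2 * c \<and> cj c = c"
proof (cases "c = 0")
  case True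
  then have "B = 0" using ns B by (auto simp: nonzero_squares_iff)
  then show ?thesis using True by simp
next
  case False
  have "cj (B ^ 2 - 4 * c * cj c) = B ^ 2 - 4 * c * cj c" using B by (simp add: ac_simps)
  then obtain y where y: "y ^ 2 = B ^ 2 - 4 * c * cj c" "cj y = - y"
    using sqrt_of_nonsquare ns by blast
  have root: "(s - B) / (2 * c) = 1" if s: "s = y \<or> s = - y" for s
  proof (rule uniq)
    have s2: "s ^ 2 = B ^ 2 - 4 * c * cj c" and cs: "cj s = - s" using s y by auto
    have "(s - B) * (- s - B) = 4 * c * cj c" using s2 by algebra
    then show "(s - B) / (2 * c) \<in> mu" using False cs B by (simp add: mu_iff)
    define z where "z = (s - B) / (2 * c)"
    have "s = B + 2 * c * z" using False by (simp add: z_def)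
    then have "4 * c * (c * z ^ 2 + B * z + cj c) = 0" using s2 by algebra
    then show "c * ((s - B) / (2 * c)) ^ 2 + B * ((s - B) / (2 * c)) + cj c = 0"
      using False by (simp add: z_def)
  qed
  have 1: "y - B = 2 * c" and 2: "- y - B = 2 * c"
    using root[of y] root[of "- y"] False by (simp_all add: divide_eq_eq)
  then have "2 * (- B) = 2 * (2 * c)" by (simp add: algebra_simps)
  then have "- B = 2 * c" unfolding mult_cancel_left by simp
  then have Bc: "B = - 2 * c" by (metis minus_minus mult_minus_left)
  moreover have "2 * cj c = 2 * c" using B unfolding Bc by simp
  ultimately show ?thesis by simp
qed

end

section \<open>Reduction to the circle\<close>

locale trinomial = quadratic_ext p h q cj
  for p h q :: nat and cj :: "'a::{field,finite} \<Rightarrow> 'a" +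
  fixes a b :: 'a
  assumes a_nonzero: "a \<noteq> 0" and b_nonzero: "b \<noteq> 0"
begin

definition N :: "'a \<Rightarrow> 'a" where "N x = cj a * x ^ 3 + x ^ 2 + cj b"

definition D :: "'a \<Rightarrow> 'a" where "D x = b * x ^ 3 + x + a"

definition k :: 'a where "k = a * cj a - b * cj b"

text \<open>\<open>\<alpha>\<close>, \<open>\<beta>\<close>, \<open>\<gamma>\<close> are the
  coefficients in \<open>y\<close> of \<open>N x * D y - N y * D x\<close> divided by
  \<open>x - y\<close>.\<close>

definition \<alpha> :: "'a \<Rightarrow> 'a" where "\<alpha> x = - b * x ^ 2 + cj a * x + k"

definition \<beta> :: "'a \<Rightarrow> 'a" where "\<beta> x = cj a * x ^ 2 + (k + 1) * x + a"

definition \<gamma> :: "'a \<Rightarrow> 'a" where "\<gamma> x = k * x ^ 2 + a * x - cj b"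

text \<open>The cross-multiplied form avoids presupposing that \<open>D\<close> has no zero on the
  circle; that becomes a consequence, since at a common zero of \<open>N\<close> and
  \<open>D\<close> the equation holds against every other point.\<close>

definition mu_injective :: bool where
  "mu_injective \<longleftrightarrow> (\<forall>x\<in>mu. \<forall>y\<in>mu. N x * D y = N y * D x \<longrightarrow> x = y)"

definition f :: "'a \<Rightarrow> 'a" where
  "f x = x * (1 + a * x ^ (q * (q - 1)) + b * x ^ (2 * (q - 1)))"

lemma cj_k [simp]: "cj k = k"
  by (simp add: k_def mult.commute)

lemma N_D_diff: "N x * D y - N y * D x = (x - y) * (\<alpha> x * y ^ 2 + \<beta> x * y + \<gamma> x)"
  unfolding N_def D_def \<alpha>_def \<beta>_def \<gamma>_def k_def
  by (simp add: algebra_simps power2_eq_square power3_eq_cube)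

text \<open>On the circle \<open>cj x = 1 / x\<close>, so conjugation reverses the coefficient
  lists: \<open>D\<close> goes to \<open>N\<close>, \<open>\<alpha>\<close> to
  \<open>\<gamma>\<close>, and \<open>\<beta>\<close> to itself, up to powers of
  \<open>x\<close>.\<close>

lemma
  assumes "x \<in> mu"
  shows cj_D: "cj (D x) = N x / x ^ 3"
    and cj_\<alpha>: "cj (\<alpha> x) = \<gamma> x / x ^ 2"
    and cj_\<beta>: "cj (\<beta> x / x) = \<beta> x / x"
  using mu_nonzero[OF assms]
  by (simp_all add: cj_mu[OF assms] N_def D_def \<alpha>_def \<beta>_def \<gamma>_def field_simps power2_eq_square power3_eq_cube)

lemma D_nonzero_if_mu_injective:
  assumes "mu_injective" "x \<in> mu"
  shows "D x \<noteq> 0"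
proof
  assume 0: "D x = 0"
  then have "N x = 0" using cj_D[OF assms(2)] mu_nonzero[OF assms(2)] by simp
  then have "N x * D (- x) = N (- x) * D x" using 0 by simp
  then show False using assms minus_mu[OF assms(2)] unfolding mu_injective_def by metis
qed

lemma f_0 [simp]: "f 0 = 0"
  by (simp add: f_def)

text \<open>With \<open>x = X ^ (q - 1)\<close> the exponent \<open>q * (q - 1)\<close> yields
  \<open>1 / x\<close>. Consequently \<open>f\<close> induces \<open>N / D\<close> on the circle
  through \<open>X \<mapsto> X ^ (q - 1)\<close>.\<close>

lemma
  assumes "X \<noteq> 0"
  shows power_in_mu: "X ^ (q - 1) \<in> mu"
    and cj_eq_mult_power: "cj X = X * X ^ (q - 1)"
    and f_eq_D: "f X = X * D (X ^ (q - 1)) / X ^ (q - 1)"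
    and cj_f: "cj (f X) = X * N (X ^ (q - 1)) / X ^ (q - 1)"
proof -
  let ?x = "X ^ (q - 1)"
  show cjX: "cj X = X * ?x" using q_ge_5 by (simp add: cj_eq flip: power_Suc)
  have "?x ^ (q + 1) = X ^ ((q - 1) * (q + 1))" by (rule power_mult[symmetric])
  then show x: "?x \<in> mu" unfolding q2_minus_1 using power_q2_minus_1[OF assms] by (simp add: mu_def)
  note cjx = cj_mu[OF x] and x0 = mu_nonzero[OF x]
  have "X ^ (q * (q - 1)) = cj ?x" by (simp add: cj_eq mult.commute flip: power_mult)
  moreover have "X ^ (2 * (q - 1)) = ?x ^ 2" by (simp add: mult.commute flip: power_mult)
  ultimately show fX: "f X = X * D ?x / ?x" using x0 unfolding f_def cjx D_def
    by (simp add: field_simps power2_eq_square power3_eq_cube)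
  show "cj (f X) = X * N ?x / ?x" unfolding fX cj_divide cj_mult cj_D[OF x] cjX cjx using x0
    by (simp add: field_simps power3_eq_cube power2_eq_square)
qed

text \<open>The fibres of \<open>X \<mapsto> X ^ (q - 1)\<close> on nonzero elements are the cosets
  of the nonzero subfield elements, and \<open>f\<close> is linear along each of them, so only the
  induced map on the circle matters.\<close>

lemma bij_f_iff_mu_injective: "bij f \<longleftrightarrow> mu_injective"
proof
  assume "bij f"
  then have inj: "f X = f Y \<Longrightarrow> X = Y" for X Y by (simp add: bij_def inj_eq)
  show mu_injective unfolding mu_injective_def
  proof (intro ballI impI)
    fix x y assume xy: "x \<in> mu" "y \<in> mu" and eq: "N x * D y = N y * D x"
    obtain X where X: "X \<noteq> 0" "X ^ (q - 1) = x" using hilbert90_mu[OF xy(1)] .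
    obtain Y where Y: "Y \<noteq> 0" "Y ^ (q - 1) = y" using hilbert90_mu[OF xy(2)] .
    have f0: "f X \<noteq> 0" "f Y \<noteq> 0" using inj[of X 0] inj[of Y 0] X Y by auto
    \<comment> \<open>Equal values on the circle make this ratio a subfield element; rescaling
      \<open>Y\<close> by it keeps \<open>y\<close> and makes the values of \<open>f\<close>
      agree.\<close>
    define c where "c = f X / f Y"
    have "cj (f X) * f Y = cj (f Y) * f X"
      unfolding cj_f[OF X(1)] cj_f[OF Y(1)] unfolding f_eq_D[OF X(1)] f_eq_D[OF Y(1)] X Y
      using eq by (simp add: mult.commute mult.left_commute)
    then have "cj c = c" using f0 by (simp add: c_def field_simps)
    moreover have "c \<noteq> 0" using f0 by (simp add: c_def)
    ultimately have "c ^ (q - 1) = 1" using cj_eq_mult_power[of c] by simp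
    then have cY: "(c * Y) ^ (q - 1) = y" using Y by (simp add: power_mult_distrib)
    have "f (c * Y) = c * f Y"
      using f_eq_D[of "c * Y"] f_eq_D[of Y] Y \<open>c \<noteq> 0\<close> unfolding cY by simp
    also have "\<dots> = f X" using f0 by (simp add: c_def)
    finally have "c * Y = X" by (rule inj)
    then show "x = y" using cY X by simp
  qed
next
  assume inj: mu_injective
  have f0: "f X \<noteq> 0" if "X \<noteq> 0" for X
    using f_eq_D[OF that] D_nonzero_if_mu_injective[OF inj power_in_mu[OF that]] that by simp
  have "X = Y" if eq: "f X = f Y" for X Y
  proof (cases "X = 0 \<or> Y = 0")
    case True
    then show ?thesis using eq f0 by (metis f_0)
  next
    case False
    then have XY: "X \<noteq> 0" "Y \<noteq> 0" by auto
    define x y where "x = X ^ (q - 1)" and "y = Y ^ (q - 1)"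
    have mu: "x \<in> mu" "y \<in> mu" using power_in_mu XY by (simp_all add: x_def y_def)
    note nz = mu_nonzero[OF mu(1)] mu_nonzero[OF mu(2)]
    have fD: "f X = X * D x / x" "f Y = Y * D y / y" and
      fN: "cj (f X) = X * N x / x" "cj (f Y) = Y * N y / y"
      unfolding x_def y_def by (rule f_eq_D cj_f; fact XY)+
    have "cj (f X) * f Y = cj (f Y) * f X" by (simp only: eq)
    then have "X * Y * (N x * D y) = X * Y * (N y * D x)"
      unfolding fN unfolding fD using nz by (simp add: field_simps)
    then have "N x * D y = N y * D x" unfolding mult_cancel_left using XY by auto
    then have xy: "x = y" using inj mu unfolding mu_injective_def by blast
    then have "X * (D x / x) = Y * (D x / x)" using eq unfolding fD by simp
    moreover have "D x / x \<noteq> 0"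
      using D_nonzero_if_mu_injective[OF inj mu(1)] nz by simp
    ultimately show ?thesis unfolding mult_cancel_right by blast
  qed
  then have "inj f" by (rule injI)
  then show "bij f" by (simp add: bij_def finite_UNIV_inj_surj)
qed

section \<open>The discriminant of the quadratic in \<open>y\<close>, and its values on the
  circle\<close>

definition P :: "'a poly" where
  "P = [:a ^ 2 + 4 * cj b * k, 2 * (a * (1 - k) + 2 * cj a * cj b), 1 - 6 * b * cj b - 3 * k ^ 2,
     2 * (cj a * (1 - k) + 2 * a * b), cj a ^ 2 + 4 * b * k:]"

lemma poly_P: "poly P x = \<beta> x ^ 2 - 4 * \<alpha> x * \<gamma> x"
  unfolding P_def \<alpha>_def \<beta>_def \<gamma>_def k_def by (simp add: algebra_simps power2_eq_square)

lemma poly_pderiv_P: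
  "poly (pderiv P) x = 2 * \<beta> x * (2 * cj a * x + (k + 1)) - 4 * (- 2 * b * x + cj a) * \<gamma> x
     - 4 * \<alpha> x * (2 * k * x + a)"
  unfolding P_def \<alpha>_def \<beta>_def \<gamma>_def k_def by (simp add: pderiv_pCons algebra_simps power2_eq_square)

lemma discriminant_on_mu:
  assumes "x \<in> mu"
  shows "(\<beta> x / x) ^ 2 - 4 * \<alpha> x * cj (\<alpha> x) = poly P x / x ^ 2"
  unfolding poly_P cj_\<alpha>[OF assms] using mu_nonzero[OF assms] by (simp add: field_simps)

text \<open>Substituting \<open>y = x z\<close> keeps \<open>z\<close> on the circle and makes the
  quadratic self-conjugate; the root \<open>y = x\<close> becomes \<open>z = 1\<close>.\<close>

lemma quadratic_scaled:
  assumes "x \<in> mu"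
  shows "\<alpha> x * (x * z) ^ 2 + \<beta> x * (x * z) + \<gamma> x =
    x ^ 2 * (\<alpha> x * z ^ 2 + (\<beta> x / x) * z + cj (\<alpha> x))"
  unfolding cj_\<alpha>[OF assms] using mu_nonzero[OF assms] by (simp add: field_simps power2_eq_square)

lemma mu_injective_disc_cases:
  assumes inj: mu_injective and x: "x \<in> mu"
  shows "poly P x / x ^ 2 \<in> nonzero_squares_Fq q \<or> \<beta> x = - 2 * \<alpha> x * x \<and> \<gamma> x = \<alpha> x * x ^ 2"
proof (cases "poly P x / x ^ 2 \<in> nonzero_squares_Fq q")
  case False
  have "\<beta> x / x = - 2 * \<alpha> x \<and> cj (\<alpha> x) = \<alpha> x"
  proof (rule self_conjugate_quadratic_double_root[OF cj_\<beta>[OF x]])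
    show "(\<beta> x / x) ^ 2 - 4 * \<alpha> x * cj (\<alpha> x) \<notin> nonzero_squares_Fq q"
      using False unfolding discriminant_on_mu[OF x] .
    fix z assume z: "z \<in> mu" "\<alpha> x * z ^ 2 + \<beta> x / x * z + cj (\<alpha> x) = 0"
    then have "N x * D (x * z) - N (x * z) * D x = 0"
      unfolding N_D_diff quadratic_scaled[OF x] by simp
    then have "N x * D (x * z) = N (x * z) * D x" by simp
    then have "x = x * z" using inj x mult_mu[OF x z(1)] unfolding mu_injective_def by blast
    then show "z = 1" using mu_nonzero[OF x] by simp
  qed
  then show ?thesis using cj_\<alpha>[OF x] mu_nonzero[OF x] by (simp add: field_simps)
qed simp

lemma square_quartic_if_mu_injective:
  assumes inj: mu_injective
  shows "square_quartic (a ^ 2 + 4 * cj b * k) (2 * (a * (1 - k) + 2 * cj a * cj b))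
     (1 - 6 * b * cj b - 3 * k ^ 2) (2 * (cj a * (1 - k) + 2 * a * b)) (cj a ^ 2 + 4 * b * k)"
proof (rule quartic_square_if_squares_on_mu, goal_cases)
  case (4 x)
  have "poly P x / x ^ 2 \<in> nonzero_squares_Fq q \<or> poly P x = 0 \<and> poly (pderiv P) x = 0"
  proof (cases "poly P x / x ^ 2 \<in> nonzero_squares_Fq q")
    case False
    then have eq: "\<beta> x = - 2 * \<alpha> x * x" "\<gamma> x = \<alpha> x * x ^ 2"
      using mu_injective_disc_cases[OF inj 4] by auto
    have "poly P x = 0" unfolding poly_P eq by (simp add: algebra_simps power2_eq_square)
    \<comment> \<open>After inserting \<open>eq\<close> the derivative is
      \<open>- 4 * \<alpha> x\<close> times the sum of the partial derivatives in \<open>x\<close>,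
      taken at \<open>y = x\<close>. By symmetry in \<open>x\<close> and \<open>y\<close> this sum
      is also the derivative in \<open>y\<close>, namely
      \<open>\<beta> x + 2 * \<alpha> x * x\<close>.\<close>
    moreover have "poly (pderiv P) x = - 4 * \<alpha> x * (\<beta> x + 2 * \<alpha> x * x)"
      unfolding poly_pderiv_P eq(2) using eq(1) unfolding \<alpha>_def \<beta>_def by algebra
    then have "poly (pderiv P) x = 0" unfolding eq by simp
    ultimately show ?thesis by simp
  qed simp
  then show ?case unfolding P_def .
qed (simp_all add: ac_simps)

end

section \<open>The two families\<close>

text \<open>
  The third alternative is the case in which \<open>N\<close> and \<open>D\<close> have a common zero on the circle.
\<close>

lemma trinomial_cases:
  fixes a a' b b' k :: "'a::field"
  assumes two: "(2::'a) \<noteq> 0" and a: "a \<noteq> 0" "a' \<noteq> 0" and k: "k = a * a' - b * b'"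
    and sq: "square_quartic (a ^ 2 + 4 * b' * k) (2 * (a * (1 - k) + 2 * a' * b')) (1 - 6 * b * b' - 3 * k ^ 2)
      (2 * (a' * (1 - k) + 2 * a * b)) (a' ^ 2 + 4 * b * k)"
  shows "a * k + a' * b' = 0 \<or> a' + 3 * a * b = 0 \<or>
    a * a' * (1 - k) + a ^ 2 * b + a' ^ 2 * b' - k * (1 - k) ^ 2 + 4 * b * b' * k = 0"
proof (cases "a ^ 2 * b = a' ^ 2 * b'")
  case False
  have sixteen: "(16::'a) \<noteq> 0" using two by (metis mult_2 mult_eq_0_iff numeral_Bit0)
  \<comment> \<open>The first equation of \<open>square_quartic\<close> factors, and only the third
    alternative survives in this case.\<close>
  have "(2 * (a' * (1 - k) + 2 * a * b)) ^ 2 * (a ^ 2 + 4 * b' * k) -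
      (2 * (a * (1 - k) + 2 * a' * b')) ^ 2 * (a' ^ 2 + 4 * b * k) =
      16 * (a ^ 2 * b - a' ^ 2 * b') *
       (a * a' * (1 - k) + a ^ 2 * b + a' ^ 2 * b' - k * (1 - k) ^ 2 + 4 * b * b' * k)"
    by (simp add: algebra_simps power2_eq_square)
  then have "16 * (a ^ 2 * b - a' ^ 2 * b') *
      (a * a' * (1 - k) + a ^ 2 * b + a' ^ 2 * b' - k * (1 - k) ^ 2 + 4 * b * b' * k) = 0"
    using sq unfolding square_quartic_def by simp
  then show ?thesis using False sixteen by simp
next
  case True
  \<comment> \<open>Now \<open>b\<close> and \<open>b'\<close> are \<open>v * a' / a\<close> and
    \<open>v * a / a'\<close>, so everything depends on \<open>A\<close> and \<open>v\<close>. The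
    second equation of \<open>square_quartic\<close> becomes
    \<open>T * (1 + 3 * v) * (A - v ^ 2 + v) ^ 3 = 0\<close>, whose factors lead to the third,
    second and first alternative.\<close>
  define v A T G where "v = a * b / a'" and "A = a * a'" and "T = 1 - k + 2 * v" and "G = A + 4 * v * k"
  have A: "A \<noteq> 0" using a by (simp add: A_def)
  have b: "b = v * a' / a" using a by (simp add: v_def)
  have b': "b' = v * a / a'" using a True by (simp add: v_def field_simps power2_eq_square)
  have bb: "b * b' = v ^ 2" using a by (simp add: b b' power2_eq_square)
  have k: "k = A - v ^ 2" using k by (simp add: A_def bb)
  have t: "a' * (1 - k) + 2 * a * b = a' * T" "a * (1 - k) + 2 * a' * b' = a * T"
    using a unfolding T_def b b' by (simp_all add: field_simps)
  have e: "a' ^ 2 + 4 * b * k = (a' / a) * G"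
    using a unfolding G_def A_def b by (simp add: field_simps power2_eq_square)
  have m: "1 - 6 * b * b' - 3 * k ^ 2 = 1 - 6 * v ^ 2 - 3 * k ^ 2"
    using bb by (simp add: mult.assoc)
  have "(2 * (a' * T)) ^ 3 + 8 * ((a' / a) * G) ^ 2 * (2 * (a * T)) =
      4 * ((a' / a) * G) * (2 * (a' * T)) * (1 - 6 * v ^ 2 - 3 * k ^ 2)"
    using sq unfolding square_quartic_def t e m by blast
  then have "8 * (a' ^ 2 / a) * (A * T ^ 3 + 2 * G ^ 2 * T - G * T * (1 - 6 * v ^ 2 - 3 * k ^ 2)) = 0"
    using a unfolding A_def by (simp add: field_simps power2_eq_square power3_eq_cube)
  moreover have "(8::'a) \<noteq> 0" using two by (metis mult_2 mult_eq_0_iff numeral_Bit0)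
  ultimately have "A * T ^ 3 + 2 * G ^ 2 * T - G * T * (1 - 6 * v ^ 2 - 3 * k ^ 2) = 0"
    using a by simp
  moreover have "A * T ^ 3 + 2 * G ^ 2 * T - G * T * (1 - 6 * v ^ 2 - 3 * k ^ 2) =
      4 * T * (1 + 3 * v) * (A - v ^ 2 + v) ^ 3"
    unfolding G_def T_def k by (simp add: algebra_simps power2_eq_square power3_eq_cube)
  moreover have "(4::'a) \<noteq> 0" using two by (metis mult_2 mult_eq_0_iff numeral_Bit0)
  ultimately consider "T = 0" | "1 + 3 * v = 0" | "A - v ^ 2 + v = 0" by auto
  then show ?thesis
  proof cases
    case 1
    then have A': "A = (1 + v) ^ 2" unfolding T_def k by (simp add: algebra_simps power2_eq_square)
    have "a ^ 2 * b = A * v" "a' ^ 2 * b' = A * v" "a * a' = A"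
      using a by (simp_all add: A_def b b' power2_eq_square)
    then have "a * a' * (1 - k) + a ^ 2 * b + a' ^ 2 * b' - k * (1 - k) ^ 2 + 4 * b * b' * k =
      A * (1 - k) + A * v + A * v - k * (1 - k) ^ 2 + 4 * v ^ 2 * k"
      using bb by (simp add: mult.assoc)
    also have "\<dots> = 0" unfolding k A' by (simp add: algebra_simps power2_eq_square)
    finally show ?thesis by blast
  next
    case 2
    have "a' + 3 * a * b = a' * (1 + 3 * v)" using a by (simp add: b field_simps)
    then show ?thesis using 2 by simp
  next
    case 3
    have "a * k + a' * b' = a * (A - v ^ 2 + v)" using a by (simp add: b' k algebra_simps)
    then show ?thesis using 3 by simp
  qed
qed

text \<open>Here \<open>A = a * a'\<close>, \<open>B = b * b'\<close>, \<open>u = a ^ 2 * b\<close>.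
  For \<open>z = (B - k ^ 2) / (A * k + u)\<close> the first part puts \<open>a * z\<close> on the
  circle and the second makes it a zero of \<open>D\<close>.\<close>

lemma common_root_identities:
  fixes A B u u' k :: "'a::field"
  assumes k: "k = A - B" and uu: "u * u' = A ^ 2 * B" and A: "A \<noteq> 0"
    and br: "A * (1 - k) + u + u' - k * (1 - k) ^ 2 + 4 * B * k = 0"
  shows "A * (B - k ^ 2) ^ 2 = (A * k + u) * (A * k + u')"
    and "A * k + u \<noteq> 0 \<Longrightarrow> u * ((B - k ^ 2) / (A * k + u)) ^ 3 + (B - k ^ 2) / (A * k + u) + 1 = 0"
proof -
  define s s' w where "s = A * k + u" and "s' = A * k + u'" and "w = B - k ^ 2"
  have B: "B = A - k" using k by simp
  have su: "u + u' = k * (1 - k) ^ 2 - 4 * B * k - A * (1 - k)" using br by algebra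
  have u': "u' = k * (1 - k) ^ 2 - 4 * B * k - A * (1 - k) - u" using br by algebra
  have w2: "A * w ^ 2 = s * s'"
  proof -
    have "A * w ^ 2 - s * s' = A * w ^ 2 - A ^ 2 * k ^ 2 - A * k * (u + u') - u * u'"
      unfolding s_def s'_def by (simp add: algebra_simps power2_eq_square)
    also have "\<dots> = 0" unfolding uu su w_def B by (simp add: algebra_simps power2_eq_square)
    finally show ?thesis by simp
  qed
  then show "A * (B - k ^ 2) ^ 2 = (A * k + u) * (A * k + u')" by (simp only: w_def s_def s'_def)
  have us: "u * s' = A * k * u + A ^ 2 * B" unfolding s'_def using uu by (simp add: algebra_simps)
  \<comment> \<open>With \<open>z = w / s\<close> this aims at \<open>u * z ^ 2 = A * z + k\<close>,
    the combination of \<open>N\<close> and \<open>D\<close> at \<open>a * z\<close> in which the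
    cubic terms cancel.\<close>
  have "A * (u * w ^ 2 - A * w * s - k * s ^ 2) = u * (A * w ^ 2) - A ^ 2 * w * s - A * k * s ^ 2"
    by (simp add: algebra_simps power2_eq_square)
  also have "\<dots> = s * (u * s' - A ^ 2 * w - A * k * s)"
    unfolding w2 by (simp add: algebra_simps power2_eq_square)
  also have "\<dots> = 0" unfolding us s_def w_def by (simp add: algebra_simps power2_eq_square)
  finally have "u * w ^ 2 - A * w * s - k * s ^ 2 = 0" using A by (simp only: mult_eq_0_iff) simp
  then have uw: "u * w ^ 2 = A * w * s + k * s ^ 2" by (simp add: algebra_simps)
  have "u * w ^ 3 + w * s ^ 2 + s ^ 3 = w * (u * w ^ 2) + w * s ^ 2 + s ^ 3"
    by (simp add: algebra_simps power2_eq_square power3_eq_cube)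
  also have "\<dots> = s * (A * w ^ 2) + k * w * s ^ 2 + w * s ^ 2 + s ^ 3"
    unfolding uw by (simp add: algebra_simps power2_eq_square power3_eq_cube)
  also have "\<dots> = s ^ 2 * (s' + k * w + w + s)"
    unfolding w2 by (simp add: algebra_simps power2_eq_square power3_eq_cube)
  also have "s' + k * w + w + s = 0"
    unfolding s_def s'_def w_def u' B by (simp add: algebra_simps power2_eq_square)
  finally have "u * w ^ 3 + w * s ^ 2 + s ^ 3 = 0" by simp
  then show "u * ((B - k ^ 2) / (A * k + u)) ^ 3 + (B - k ^ 2) / (A * k + u) + 1 = 0"
    if "A * k + u \<noteq> 0"
    using that unfolding w_def[symmetric] s_def[symmetric]
    by (simp add: field_simps power2_eq_square power3_eq_cube)
qed

context trinomial
begin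

lemma cj_a_nonzero [simp]: "cj a \<noteq> 0" and cj_b_nonzero [simp]: "cj b \<noteq> 0"
  using a_nonzero b_nonzero by simp_all

text \<open>The third alternative of \<open>trinomial_cases\<close> gives a forbidden zero of
  \<open>D\<close> on the circle unless \<open>A * k + u = 0\<close>, and the conjugate of that is
  \<open>cj a\<close> times the first condition.\<close>

lemma conditions_if_mu_injective:
  assumes inj: mu_injective
  shows "a * k + cj a * cj b = 0 \<or> cj a + 3 * a * b = 0"
proof -
  define A B u u' where "A = a * cj a" and "B = b * cj b" and "u = a ^ 2 * b" and "u' = cj a ^ 2 * cj b"
  have "A * k + u = 0" if "a * cj a * (1 - k) + a ^ 2 * b + cj a ^ 2 * cj b - k * (1 - k) ^ 2 + 4 * b * cj b * k = 0"
  proof (rule ccontr)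
    assume s: "A * k + u \<noteq> 0"
    have AB: "k = A - B" "u * u' = A ^ 2 * B" "A \<noteq> 0"
      using a_nonzero by (simp_all add: k_def A_def B_def u_def u'_def power2_eq_square)
    have "A * (1 - k) + u + u' - k * (1 - k) ^ 2 + 4 * B * k = 0"
      using that by (simp add: A_def B_def u_def u'_def mult.assoc)
    note ids = common_root_identities[OF AB this]
    define z where "z = (B - k ^ 2) / (A * k + u)"
    define x where "x = a * z"
    have cs: "cj (A * k + u) = A * k + u'" by (simp add: A_def u_def u'_def mult.commute)
    then have s': "A * k + u' \<noteq> 0" using s by (metis cj_eq_0_iff)
    have "cj (B - k ^ 2) = B - k ^ 2" by (simp add: B_def mult.commute)
    then have "cj x = cj a * ((B - k ^ 2) / (A * k + u'))" unfolding x_def z_def cj_mult cj_divide cs by simp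
    then have "x * cj x = A * (B - k ^ 2) ^ 2 / ((A * k + u) * (A * k + u'))"
      by (simp add: x_def z_def A_def power2_eq_square)
    also have "\<dots> = 1" unfolding ids(1) using s s' by simp
    finally have "x \<in> mu" by (simp add: mu_iff)
    moreover have "D x = a * (u * z ^ 3 + z + 1)"
      unfolding D_def x_def u_def by (simp add: algebra_simps power2_eq_square power3_eq_cube)
    then have "D x = 0" using ids(2)[OF s] by (simp add: z_def)
    ultimately show False using D_nonzero_if_mu_injective[OF inj] by blast
  qed
  moreover have "a * k + cj a * cj b = 0" if "A * k + u = 0"
  proof -
    have "cj (A * k + u) = 0" using that by simp
    then have "cj a * (a * k + cj a * cj b) = 0"
      by (simp add: A_def u_def algebra_simps power2_eq_square)
    then show ?thesis using a_nonzero by simp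
  qed
  ultimately show ?thesis
    using trinomial_cases[OF two_nonzero a_nonzero cj_a_nonzero k_def square_quartic_if_mu_injective[OF inj]]
    by blast
qed

section \<open>Case I: the quadratic separates\<close>

lemma case_I_relations:
  assumes I: "a * k + cj a * cj b = 0"
  shows "k \<noteq> 0" "a * b = - (cj a * k)" "cj a * cj b = - (a * k)" "a * cj a = k + k ^ 2" "b * cj b = k ^ 2"
proof -
  show "k \<noteq> 0"
  proof
    assume "k = 0"
    then have "cj a * cj b = 0" using I by simp
    then show False using a_nonzero b_nonzero by simp
  qed
  have "cj (a * k + cj a * cj b) = 0" using I by simp
  then have "cj a * k + a * b = 0" by simp
  then show ab: "a * b = - (cj a * k)" by (simp add: eq_neg_iff_add_eq_0 add.commute)
  show ab': "cj a * cj b = - (a * k)" using I by (simp add: eq_neg_iff_add_eq_0 add.commute)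
  \<comment> \<open>The relation is multiplied by its conjugate.\<close>
  have "(a * cj a) * (b * cj b) = (a * b) * (cj a * cj b)" by (simp only: ac_simps)
  also have "\<dots> = (a * cj a) * k ^ 2" unfolding ab ab' by (simp add: power2_eq_square ac_simps)
  finally show B: "b * cj b = k ^ 2" using a_nonzero by simp
  have "a * cj a = k + b * cj b" unfolding k_def by simp
  then show "a * cj a = k + k ^ 2" unfolding B .
qed

text \<open>All three coefficients are constants times one quadratic \<open>Q\<close> in
  \<open>x\<close>, so the symmetric expression splits into a product of values of
  \<open>Q\<close>.\<close>

lemma case_I_factorization:
  assumes I: "a * k + cj a * cj b = 0"
  shows "\<alpha> x * y ^ 2 + \<beta> x * y + \<gamma> x =
    - b * (x ^ 2 + (a / k) * x + a / cj a) * (y ^ 2 + (a / k) * y + a / cj a)"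
proof -
  note r = case_I_relations[OF I]
  define Q where "Q = x ^ 2 + (a / k) * x + a / cj a"
  have "- b * (a / k) = - (a * b) / k" "- b * (a / cj a) = - (a * b) / cj a"
    "k * (a / cj a) = - (- (a * k)) / cj a" by simp_all
  then have 1: "- b * (a / k) = cj a" "- b * (a / cj a) = k" "k * (a / cj a) = - cj b"
    unfolding r(2) r(3)[symmetric] using r(1) a_nonzero by simp_all
  have lin: "- b * (t ^ 2 + (a / k) * t + a / cj a) = - b * t ^ 2 + cj a * t + k" for t
    by (simp only: distrib_left mult.assoc[symmetric] 1)
  have "cj a * (a / k) = k + 1" using r(1) r(4) by (simp add: field_simps power2_eq_square)
  moreover have "cj a * (a / cj a) = a" using a_nonzero by simp
  ultimately have "\<beta> x = cj a * Q"
    unfolding \<beta>_def Q_def by (simp only: distrib_left mult.assoc[symmetric])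
  moreover have "k * (a / k) = a" using r(1) by simp
  then have "\<gamma> x = k * Q"
    unfolding \<gamma>_def Q_def by (simp only: distrib_left mult.assoc[symmetric] 1) simp
  moreover have "\<alpha> x = - b * Q" unfolding Q_def lin \<alpha>_def ..
  ultimately have "\<alpha> x * y ^ 2 + \<beta> x * y + \<gamma> x = Q * (- b * y ^ 2 + cj a * y + k)"
    by (simp add: algebra_simps)
  then show ?thesis unfolding lin[symmetric] Q_def by (simp only: ac_simps)
qed

text \<open>Completing the square writes a root as \<open>(a / k) * (s - 1) / 2\<close> with
  \<open>s ^ 2\<close> equal to the tested quantity. It lies on the circle when
  \<open>cj s = - s\<close>; a nonzero fixed \<open>s\<close> would have to be 1, which
  \<open>b \<noteq> 0\<close> excludes.\<close>

lemma case_I_root_iff: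
  assumes I: "a * k + cj a * cj b = 0"
  shows "(\<exists>x\<in>mu. x ^ 2 + (a / k) * x + a / cj a = 0) \<longleftrightarrow>
    1 - 4 * (b * cj b / (a * cj a)) \<notin> nonzero_squares_Fq q"
proof -
  note r = case_I_relations[OF I]
  let ?d = "1 - 4 * (b * cj b / (a * cj a))"
  have Q: "x ^ 2 + (a / k) * x + a / cj a = (a / k) ^ 2 * (s ^ 2 - ?d) / 4"
    if "x = (a / k) * (s - 1) / 2" for x s
  proof -
    have "x ^ 2 + (a / k) * x = (a / k) ^ 2 * (s ^ 2 - 1) / 4"
      unfolding that using r(1) by (simp add: power2_eq_square field_simps)
    moreover have "a / cj a = (a / k) ^ 2 * (1 - ?d) / 4"
      unfolding r(5) using r(1) a_nonzero by (simp add: power2_eq_square)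
    ultimately have "x ^ 2 + (a / k) * x + a / cj a = (a / k) ^ 2 * (s ^ 2 - 1) / 4 + (a / k) ^ 2 * (1 - ?d) / 4"
      by simp
    then show ?thesis by (simp only: add_divide_distrib[symmetric] distrib_left[symmetric]) simp
  qed
  have norm: "(a / k) * (cj a / k) * (1 - ?d) / 4 = 1"
    unfolding r(5) using r(1) a_nonzero by (simp add: power2_eq_square)
  have cd: "cj ?d = ?d" by (simp add: mult.commute)
  show ?thesis
  proof
    assume "\<exists>x\<in>mu. x ^ 2 + (a / k) * x + a / cj a = 0"
    then obtain x where x: "x \<in> mu" "x ^ 2 + (a / k) * x + a / cj a = 0" by blast
    define s where "s = 2 * x * k / a + 1"
    have xs: "x = (a / k) * (s - 1) / 2" using r(1) a_nonzero by (simp add: s_def)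
    then have "(a / k) ^ 2 * (s ^ 2 - ?d) / 4 = 0" using Q x(2) by metis
    then have s2: "s ^ 2 = ?d" using r(1) a_nonzero by simp
    show "?d \<notin> nonzero_squares_Fq q"
    proof
      assume "?d \<in> nonzero_squares_Fq q"
      then obtain y where y: "cj y = y" "y \<noteq> 0" "?d = y ^ 2" by (auto simp: nonzero_squares_iff)
      then have "s = y \<or> s = - y" using s2 by (simp add: power2_eq_iff)
      then have s: "cj s = s" "s \<noteq> 0" using y by auto
      have cx: "cj x = (cj a / k) * (s - 1) / 2" unfolding xs using s by simp
      have "(a / k) * (cj a / k) * (s - 1) ^ 2 / 4 = ((a / k) * (s - 1) / 2) * ((cj a / k) * (s - 1) / 2)"
        by (simp add: power2_eq_square mult_ac)
      also have "\<dots> = x * cj x" unfolding cx by (simp only: xs)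
      also have "\<dots> = (a / k) * (cj a / k) * (1 - s ^ 2) / 4" using x(1) norm unfolding s2 by (simp add: mu_iff)
      finally have "(a / k) * (cj a / k) * (s - 1) ^ 2 = (a / k) * (cj a / k) * (1 - s ^ 2)" by simp
      then have "(s - 1) ^ 2 = 1 - s ^ 2" unfolding mult_cancel_left using r(1) a_nonzero by simp
      then have "2 * s * (s - 1) = 0" by (simp add: algebra_simps power2_eq_square)
      then have "?d = 1" using s s2 by simp
      then show False using a_nonzero b_nonzero by simp
    qed
  next
    assume "?d \<notin> nonzero_squares_Fq q"
    then obtain y where y: "y ^ 2 = ?d" "cj y = - y" using sqrt_of_nonsquare[OF cd] by blast
    define x where "x = (a / k) * (y - 1) / 2"
    have cx: "cj x = (cj a / k) * (- y - 1) / 2" unfolding x_def using y by simp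
    have "x * cj x = (a / k) * (cj a / k) * ((y - 1) * (- y - 1)) / 4"
      unfolding cx by (simp add: x_def mult_ac)
    also have "(y - 1) * (- y - 1) = 1 - y ^ 2" by (simp add: algebra_simps power2_eq_square)
    finally have "x \<in> mu" using norm unfolding y(1) by (simp add: mu_iff)
    moreover have "x ^ 2 + (a / k) * x + a / cj a = 0" using Q[OF x_def] y(1) by simp
    ultimately show "\<exists>x\<in>mu. x ^ 2 + (a / k) * x + a / cj a = 0" by blast
  qed
qed

lemma case_I:
  assumes I: "a * k + cj a * cj b = 0"
  shows "mu_injective \<longleftrightarrow> 1 - 4 * (b * cj b / (a * cj a)) \<in> nonzero_squares_Fq q"
proof -
  have "mu_injective \<longleftrightarrow> (\<forall>x\<in>mu. x ^ 2 + (a / k) * x + a / cj a \<noteq> 0)"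
  proof
    assume inj: mu_injective
    show "\<forall>x\<in>mu. x ^ 2 + (a / k) * x + a / cj a \<noteq> 0"
    proof (rule ballI, rule notI)
      fix x assume x: "x \<in> mu" "x ^ 2 + (a / k) * x + a / cj a = 0"
      then have "N x * D (- x) - N (- x) * D x = 0"
        unfolding N_D_diff case_I_factorization[OF I] by simp
      then have "N x * D (- x) = N (- x) * D x" by simp
      then show False using inj x(1) minus_mu[OF x(1)] unfolding mu_injective_def by metis
    qed
  next
    assume nz: "\<forall>x\<in>mu. x ^ 2 + (a / k) * x + a / cj a \<noteq> 0"
    show mu_injective unfolding mu_injective_def
    proof (intro ballI impI)
      fix x y assume xy: "x \<in> mu" "y \<in> mu" "N x * D y = N y * D x"
      then have "(x - y) * (- b * (x ^ 2 + (a / k) * x + a / cj a) * (y ^ 2 + (a / k) * y + a / cj a)) = 0"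
        using N_D_diff[of x y] unfolding case_I_factorization[OF I] by simp
      then show "x = y" using nz xy b_nonzero by auto
    qed
  qed
  then show ?thesis using case_I_root_iff[OF I] by blast
qed

section \<open>Case II: the discriminant is a constant times a square\<close>

lemma case_II_relations:
  assumes II: "cj a + 3 * a * b = 0"
  shows "b = - (cj a / (3 * a))" "cj b = - (a / (3 * cj a))" "b * cj b = 1 / 9" "k = a * cj a - 1 / 9"
proof -
  have "3 * a * b = - cj a" using II by (simp add: eq_neg_iff_add_eq_0 add.commute)
  then show b: "b = - (cj a / (3 * a))" using a_nonzero by (simp add: field_simps)
  have "cj b = cj (- (cj a / (3 * a)))" by (simp only: b[symmetric])
  then show b': "cj b = - (a / (3 * cj a))" by simp
  show B: "b * cj b = 1 / 9" using a_nonzero by (simp add: b') (simp add: b)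
  show "k = a * cj a - 1 / 9" unfolding k_def B ..
qed

text \<open>Up to a constant factor, \<open>v x ^ 2\<close> is the normalised discriminant in case
  II.\<close>

definition v :: "'a \<Rightarrow> 'a" where "v x = x / a + 3 + 1 / (cj a * x)"

lemma cj_v: "x \<in> mu \<Longrightarrow> cj (v x) = v x"
  unfolding v_def by (simp add: cj_mu)

lemma case_II_discriminant:
  assumes II: "cj a + 3 * a * b = 0" and x: "x \<in> mu"
  shows "27 * (poly P x / x ^ 2) = (4 - 9 * (a * cj a)) * (a * cj a) * v x ^ 2"
proof -
  note r = case_II_relations[OF II] and x0 = mu_nonzero[OF x]
  define A where "A = a * cj a"
  have cA: "cj a = A / a" using a_nonzero by (simp add: A_def)
  have A0: "A \<noteq> 0" using a_nonzero by (simp add: A_def)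
  have P: "P = [:a ^ 2 + 4 * cj b * k, 2 * (a * (1 - k) + 2 * cj a * cj b), 1 - 6 * (b * cj b) - 3 * k ^ 2,
     2 * (cj a * (1 - k) + 2 * a * b), cj a ^ 2 + 4 * b * k:]"
    unfolding P_def by (simp add: mult.assoc)
  have c: "27 * (a ^ 2 + 4 * cj b * k) = (4 - 9 * A) * (a ^ 2 / A)"
    "27 * (2 * (a * (1 - k) + 2 * cj a * cj b)) = (4 - 9 * A) * (6 * a)"
    "27 * (1 - 6 * (b * cj b) - 3 * k ^ 2) = (4 - 9 * A) * (9 * A + 2)"
    "27 * (2 * (cj a * (1 - k) + 2 * a * b)) = (4 - 9 * A) * (6 * A / a)"
    "27 * (cj a ^ 2 + 4 * b * k) = (4 - 9 * A) * (A / a ^ 2)"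
    unfolding r(4) r(3) unfolding r(1,2) A_def using a_nonzero
    by (simp_all add: field_simps power2_eq_square)
  \<comment> \<open>Horner form with \<open>w\<close> attached to each coefficient lets the
    equations \<open>c\<close> act as rewrite rules.\<close>
  have expand: "w * poly [:c0, c1, c2, c3, c4:] x = w * c0 + x * (w * c1 + x * (w * c2 + x * (w * c3 + x * (w * c4))))"
    for w c0 c1 c2 c3 c4 by (simp add: algebra_simps)
  have "27 * poly P x = (4 - 9 * A) * poly [:a ^ 2 / A, 6 * a, 9 * A + 2, 6 * A / a, A / a ^ 2:] x"
    unfolding P expand c ..
  also have "poly [:a ^ 2 / A, 6 * a, 9 * A + 2, 6 * A / a, A / a ^ 2:] x =
      a ^ 2 / A + x * (6 * a + x * ((9 * A + 2) + x * (6 * A / a + x * (A / a ^ 2))))"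
    by simp
  also have "a ^ 2 / A + x * (6 * a + x * ((9 * A + 2) + x * (6 * A / a + x * (A / a ^ 2)))) = A * (v x * x) ^ 2"
    unfolding v_def cA using a_nonzero A0 x0 by (simp add: field_simps power2_eq_square)
  finally have "27 * poly P x = (4 - 9 * A) * (A * (v x * x) ^ 2)" .
  then have "27 * poly P x / x ^ 2 = (4 - 9 * A) * (A * (v x * x) ^ 2) / x ^ 2" by (simp only:)
  then show ?thesis using x0 unfolding A_def[symmetric] by (simp add: power_mult_distrib)
qed

text \<open>The left side is the derivative in \<open>y\<close> of the quadratic at
  \<open>y = x\<close>. Divisibility by \<open>v\<close> means that where the discriminant vanishes
  because \<open>v x = 0\<close>, the double root is \<open>x\<close> itself, provided that
  \<open>\<alpha> x\<close> is nonzero.\<close>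

lemma case_II_derivative:
  assumes II: "cj a + 3 * a * b = 0" and x: "x \<in> mu"
  shows "\<beta> x + 2 * \<alpha> x * x = v x * (x * (2 / 3 * cj a * x + a * cj a))"
    and "v x = 0 \<Longrightarrow> \<alpha> x = a * cj a - 4 / 9"
proof -
  note r = case_II_relations[OF II] and x0 = mu_nonzero[OF x]
  show "\<beta> x + 2 * \<alpha> x * x = v x * (x * (2 / 3 * cj a * x + a * cj a))"
    unfolding \<alpha>_def \<beta>_def r(4) v_def unfolding r(1) using a_nonzero x0
    by (simp add: field_simps power2_eq_square power3_eq_cube)
  have "\<alpha> x = a * cj a - 4 / 9 + v x * (x * cj a / 3)"
    unfolding \<alpha>_def r(4) v_def unfolding r(1) using a_nonzero x0
    by (simp add: field_simps power2_eq_square power3_eq_cube)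
  then show "v x = 0 \<Longrightarrow> \<alpha> x = a * cj a - 4 / 9" by simp
qed

lemma case_II:
  assumes II: "cj a + 3 * a * b = 0"
  shows "mu_injective \<longleftrightarrow> - 3 * (1 - 4 * (b * cj b / (a * cj a))) \<in> nonzero_squares_Fq q"
proof -
  define A where "A = a * cj a"
  note r = case_II_relations[OF II]
  have A: "A \<noteq> 0" "cj A = A" using a_nonzero by (simp_all add: A_def mult.commute)
  have d: "- 3 * (1 - 4 * (b * cj b / (a * cj a))) = (4 - 9 * A) / (3 * A)"
    unfolding r(3) A_def[symmetric] using A by (simp add: field_simps)
  have disc: "27 * (poly P x / x ^ 2) = (4 - 9 * A) * A * v x ^ 2" if "x \<in> mu" for x
    using case_II_discriminant[OF II that] unfolding A_def .
  show ?thesis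
  proof
    assume inj: mu_injective
    \<comment> \<open>At such a point the exceptional alternative of
      \<open>mu_injective_disc_cases\<close> fails, so the discriminant is a nonzero square there. A
      cubic with constant term \<open>a\<close> cannot vanish on the whole circle.\<close>
    have "\<exists>x\<in>mu. \<beta> x + 2 * \<alpha> x * x \<noteq> 0"
    proof (rule ccontr)
      assume "\<not> ?thesis"
      then have 0: "\<beta> x + 2 * \<alpha> x * x = 0" if "x \<in> mu" for x using that by blast
      have "poly [:a, 3 * k + 1, 3 * cj a, - 2 * b:] x = \<beta> x + 2 * \<alpha> x * x" for x
        unfolding \<alpha>_def \<beta>_def by (simp add: algebra_simps power2_eq_square)
      then have "poly [:a, 3 * k + 1, 3 * cj a, - 2 * b:] x = 0" if "x \<in> mu" for x
        using 0[OF that] by simp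
      moreover have "degree [:a, 3 * k + 1, 3 * cj a, - 2 * b:] \<le> 3" by simp
      then have "degree [:a, 3 * k + 1, 3 * cj a, - 2 * b:] \<le> q" using q_ge_5 by linarith
      ultimately have "[:a, 3 * k + 1, 3 * cj a, - 2 * b:] = 0"
        by (rule poly_eq_0_if_zero_on_mu)
      then show False using a_nonzero by simp
    qed
    then obtain x where x: "x \<in> mu" "\<beta> x + 2 * \<alpha> x * x \<noteq> 0" by blast
    then have "\<not> (\<beta> x = - 2 * \<alpha> x * x \<and> \<gamma> x = \<alpha> x * x ^ 2)" by auto
    then obtain y where y: "cj y = y" "y \<noteq> 0" "poly P x / x ^ 2 = y ^ 2"
      using mu_injective_disc_cases[OF inj x(1)] by (auto simp: nonzero_squares_iff)
    have eq: "27 * y ^ 2 = (4 - 9 * A) * A * v x ^ 2" using disc[OF x(1)] y(3) by simp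
    then have v0: "v x \<noteq> 0" using y by auto
    \<comment> \<open>The constant \<open>(4 - 9 * A) * A / 27\<close> of the discriminant is the
      required quantity times \<open>(A / 3) ^ 2\<close>.\<close>
    have "(3 * y / (v x * A)) ^ 2 = 27 * y ^ 2 / (3 * (v x * A) ^ 2)"
      using v0 A by (simp add: field_simps power2_eq_square)
    also have "\<dots> = (4 - 9 * A) / (3 * A)"
      unfolding eq using v0 A by (simp add: power2_eq_square)
    finally have "(4 - 9 * A) / (3 * A) = (3 * y / (v x * A)) ^ 2" ..
    moreover have "cj (3 * y / (v x * A)) = 3 * y / (v x * A)" using y A cj_v[OF x(1)] by simp
    moreover have "3 * y / (v x * A) \<noteq> 0" using y v0 A by simp
    ultimately show "- 3 * (1 - 4 * (b * cj b / (a * cj a))) \<in> nonzero_squares_Fq q"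
      unfolding d nonzero_squares_iff by blast
  next
    assume "- 3 * (1 - 4 * (b * cj b / (a * cj a))) \<in> nonzero_squares_Fq q"
    then obtain s where s: "cj s = s" "s \<noteq> 0" "(4 - 9 * A) / (3 * A) = s ^ 2"
      unfolding d nonzero_squares_iff by blast
    have s3: "4 - 9 * A = 3 * A * s ^ 2" using s(3)[symmetric] A by simp
    show mu_injective unfolding mu_injective_def
    proof (intro ballI impI, rule ccontr)
      fix x y assume x: "x \<in> mu" and y: "y \<in> mu" and eq: "N x * D y = N y * D x" and neq: "x \<noteq> y"
      note x0 = mu_nonzero[OF x]
      define z where "z = y / x"
      have yz: "y = x * z" using x0 by (simp add: z_def)
      have z: "z \<in> mu" using x y by (simp add: z_def mu_def power_divide)
      have "\<alpha> x * y ^ 2 + \<beta> x * y + \<gamma> x = 0" using N_D_diff[of x y] eq neq by simp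
      then have root: "\<alpha> x * z ^ 2 + (\<beta> x / x) * z + cj (\<alpha> x) = 0"
        unfolding yz quadratic_scaled[OF x] using x0 by simp
      have "27 * (poly P x / x ^ 2) = 27 * (s * A * v x / 3) ^ 2"
        unfolding disc[OF x] s3 by (simp add: power2_eq_square)
      then have sq: "poly P x / x ^ 2 = (s * A * v x / 3) ^ 2" by (simp only: mult_cancel_left) simp
      have "poly P x / x ^ 2 \<notin> nonzero_squares_Fq q"
        using self_conjugate_quadratic_no_root_in_mu[OF cj_\<beta>[OF x] z root]
        unfolding discriminant_on_mu[OF x] .
      moreover have "cj (s * A * v x / 3) = s * A * v x / 3" using s A cj_v[OF x] by simp
      ultimately have "s * A * v x / 3 = 0" unfolding sq nonzero_squares_iff by blast
      then have v0: "v x = 0" using s A by simp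
      then have "\<beta> x = - 2 * \<alpha> x * x"
        using case_II_derivative(1)[OF II x] by (simp add: eq_neg_iff_add_eq_0)
      then have \<beta>: "\<beta> x / x = - 2 * \<alpha> x" using x0 by simp
      \<comment> \<open>With zero discriminant the quadratic is
        \<open>\<alpha> x * (z - 1) ^ 2\<close>, so a root other than 1 forces
        \<open>\<alpha> x = 0\<close>, that is \<open>9 * A = 4\<close>, against
        \<open>s \<noteq> 0\<close>.\<close>
      have "4 * \<alpha> x ^ 2 = 4 * \<alpha> x * cj (\<alpha> x)"
        using discriminant_on_mu[OF x] unfolding \<beta> sq v0 by (simp add: power2_eq_square)
      then have "\<alpha> x = 0 \<or> cj (\<alpha> x) = \<alpha> x" by (auto simp: power2_eq_square)
      moreover have "\<alpha> x * (z - 1) ^ 2 = \<alpha> x * z ^ 2 + - 2 * \<alpha> x * z + \<alpha> x"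
        by (simp add: algebra_simps power2_eq_square)
      ultimately have "\<alpha> x * (z - 1) ^ 2 = 0" using root unfolding \<beta> by auto
      moreover have "z \<noteq> 1" using neq yz by auto
      ultimately have "\<alpha> x = 0" by simp
      then have "9 * A = 4" using case_II_derivative(2)[OF II x v0] by (simp add: A_def field_simps)
      then have "s ^ 2 = 0" using s(3) by simp
      then show False using s by simp
    qed
  qed
qed

theorem bij_f_iff:
  "bij f \<longleftrightarrow>
    a * k + cj a * cj b = 0 \<and> 1 - 4 * (b * cj b / (a * cj a)) \<in> nonzero_squares_Fq q \<or>
    cj a + 3 * a * b = 0 \<and> - 3 * (1 - 4 * (b * cj b / (a * cj a))) \<in> nonzero_squares_Fq q"
  using bij_f_iff_mu_injective conditions_if_mu_injective case_I case_II by blast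

end

theorem mainTheorem1:
  fixes a b :: "'a::{field,finite}" and p h q :: nat
  assumes "prime p" and "p > 3" and "h \<ge> 1" and "q = p ^ h"
    and "card (UNIV :: 'a set) = q ^ 2"
    and "a \<noteq> 0" and "b \<noteq> 0"
  shows "is_perm_poly_fun (\<lambda>x::'a. x * (1 + a * x ^ (q * (q - 1)) + b * x ^ (2 * (q - 1))))
    \<longleftrightarrow>
      ((a ^ q * b ^ q = a * (b ^ (q + 1) - a ^ (q + 1))
          \<and> 1 - 4 * (b / a) ^ (q + 1) \<in> nonzero_squares_Fq q)
       \<or> (a ^ (q - 1) + 3 * b = 0
          \<and> - 3 * (1 - 4 * (b / a) ^ (q + 1)) \<in> nonzero_squares_Fq q))"
proof -
  interpret trinomial p h q "\<lambda>x::'a. x ^ q" a b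
    by unfold_locales (use assms in auto)
  have "f = (\<lambda>x. x * (1 + a * x ^ (q * (q - 1)) + b * x ^ (2 * (q - 1))))"
    by (rule ext) (rule f_def)
  moreover have "a * k + a ^ q * b ^ q = 0 \<longleftrightarrow> a ^ q * b ^ q = a * (b ^ (q + 1) - a ^ (q + 1))"
    unfolding k_def by (auto simp: algebra_simps eq_neg_iff_add_eq_0)
  moreover have "a ^ q + 3 * a * b = a * (a ^ (q - 1) + 3 * b)"
    using cj_eq_mult_power[OF assms(6)] by (simp add: algebra_simps)
  then have "a ^ q + 3 * a * b = 0 \<longleftrightarrow> a ^ (q - 1) + 3 * b = 0" using assms(6) by simp
  moreover have "b * b ^ q / (a * a ^ q) = (b / a) ^ (q + 1)" by (simp add: power_divide)
  ultimately show ?thesis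
    using bij_f_iff unfolding is_perm_poly_fun_def by simp
qed

end
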